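(* Let $T$ be a nonempty set endowed with an arbitrary topology $\tau$, let $f_t:X\to\overline{\mathbb{R}}$, $t\in T$, be convex functions, and let $f:=\sup_{t\in T}f_t$. For every $x\in X$ we have $$\partial f(x)=\bigcap_{L\in\mathcal{F}(x)}\operatorname{co}\left\{\bigcup_{\gamma\in\widehat{T}(x)}\partial\left(\tilde f_\gamma+\mathrm{I}_{L\cap\operatorname{dom}f}\right)(x)\right\},$$ where, for $\gamma\in\widehat{T}$ and $z\in X$, $$\tilde f_\gamma(z):=\limsup_{\gamma_t\to\gamma,\ f_t(x)\to f(x),\ t\in T}f_t(z).$$
   Context: $X$ is a real separated (Hausdorff) locally convex space with topological dual $X^*$ endowed with the $w^*$-topology; $\overline{\mathbb{R}}=\mathbb{R}\cup\{\pm\infty\}$, with the convention $(+\infty)+(-\infty)=(-\infty)+(+\infty)=+\infty$, and $\sup\emptyset=-\infty$. For $h:X\to\overline{\mathbb{R}}$, $\operatorname{dom}h=\{x:h(x)<+\infty\}$; $h$ is convex if its epigraph $\{(x,\lambda)\in X\times\mathbb{R}:h(x)\le\lambda\}$ is convex. The subdifferential is $\partial h(x)=\{x^*\in X^*: h(y)\ge h(x)+\langle x^*,y-x\rangle\ \forall y\in X\}$ if $h(x)\in\mathbb{R}$, and $\partial h(x)=\emptyset$ if $h(x)\notin\mathbb{R}$. $\mathrm{I}_A$ is the indicator function ($0$ on $A$, $+\infty$ off $A$), $\operatorname{co}$ is the convex hull. $\mathcal{F}(x)$ is the family of finite-dimensional linear subspaces $L\subset X$ containing $x$. Compactification: $\mathcal{C}(T,[0,1])$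 is the set of $\tau$-continuous functions $\varphi:T\to[0,1]$. For $t\in T$, $\gamma_t\in[0,1]^{\mathcal{C}(T,[0,1])}$ is the evaluation $\gamma_t(\varphi)=\varphi(t)$. $\widehat{T}$ is the closure of $\{\gamma_t:t\in T\}$ in $[0,1]^{\mathcal{C}(T,[0,1])}$ for the product topology (pointwise convergence). For $\gamma\in\widehat{T}$ and $z\in X$, $f_\gamma(z):=\limsup_{\gamma_t\to\gamma,\ t\in T}f_t(z)$, i.e. the supremum of $\limsup_i f_{t_i}(z)$ over all nets $(t_i)_i\subset T$ with $\gamma_{t_i}\to\gamma$ (constant nets allowed). If $f(x)\in\mathbb{R}$, $\widehat{T}(x):=\{\gamma\in\widehat{T}: f_\gamma(x)\ge f(x)\}$; if $f(x)\notin\mathbb{R}$, $\widehat{T}(x):=\emptyset$. The function $\tilde f_\gamma$ (which depends on $x$) is defined at $z$ as the supremum of $\limsup_i f_{t_i}(z)$ over all nets $(t_i)_i\subset T$ such that $\gamma_{t_i}\to\gamma$ and $f_{t_i}(x)\to f(x)$ (equal to $-\infty$ if there is no such net). *)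

theory Defs
  imports "HOL-Analysis.Analysis" "HOL-Library.Function_Algebras"
begin

section \<open>Separated locally convex spaces and their duals\<close>

class topological_real_vector = real_vector + topological_ab_group_add +
  assumes tendsto_scaleR_nhds:
    "LIM p (nhds a \<times>\<^sub>F nhds b). fst p *\<^sub>R snd p :> nhds (a *\<^sub>R b)"

class separated_lcs = topological_real_vector + t2_space +
  assumes locally_convex_unfolded: "open U \<Longrightarrow> 0 \<in> U \<Longrightarrow> \<exists>V. open V \<and> 0 \<in> V \<and> V \<subseteq> U \<and>
    (\<forall>x\<in>V. \<forall>y\<in>V. \<forall>u\<ge>0. \<forall>v\<ge>0. u + v = 1 \<longrightarrow> u *\<^sub>R x + v *\<^sub>R y \<in> V)"

lemma locally_convex:
  fixes U :: "'a::separated_lcs set"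
  assumes "open U" "0 \<in> U"
  shows "\<exists>V. open V \<and> 0 \<in> V \<and> V \<subseteq> U \<and> convex V"
  using locally_convex_unfolded[OF assms] unfolding convex_def .

text \<open>Pointwise scaling, so that \<open>convex hull\<close> applies to sets of functionals.\<close>

instantiation "fun" :: (type, real_vector) real_vector
begin

definition scaleR_fun_def: "r *\<^sub>R f = (\<lambda>x. r *\<^sub>R f x)"

instance
  by standard (simp_all add: scaleR_fun_def plus_fun_def scaleR_add_right scaleR_add_left)

end

definition dual_space :: "('a::separated_lcs \<Rightarrow> real) set" where
  "dual_space = {\<phi>. linear \<phi> \<and> continuous_on UNIV \<phi>}"

definition fin_dim_subspaces :: "'a::real_vector \<Rightarrow> 'a set set" where
  "fin_dim_subspaces x = {L. subspace L \<and> (\<exists>B. finite B \<and> L = span B) \<and> x \<in> L}"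


section \<open>Extended-real-valued convex functions\<close>

text \<open>Addition on \<^typ>\<open>ereal\<close> satisfies \<open>\<infinity> + -\<infinity> = -\<infinity> + \<infinity> = \<infinity>\<close>.\<close>

definition edom :: "('a \<Rightarrow> ereal) \<Rightarrow> 'a set" where
  "edom h = {x. h x < \<infinity>}"

definition econvex :: "('a::real_vector \<Rightarrow> ereal) \<Rightarrow> bool" where
  "econvex h \<longleftrightarrow> convex {(x, r::real). h x \<le> ereal r}"

definition eindicator :: "'a set \<Rightarrow> 'a \<Rightarrow> ereal" where
  "eindicator A x = (if x \<in> A then 0 else \<infinity>)"

definition subdifferential :: "('a::separated_lcs \<Rightarrow> ereal) \<Rightarrow> 'a \<Rightarrow> ('a \<Rightarrow> real) set" where
  "subdifferential h x =
    (if \<bar>h x\<bar> \<noteq> \<infinity> then {\<phi> \<in> dual_space. \<forall>y. h x + ereal (\<phi> (y - x)) \<le> h y} else {})"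


section \<open>The compactification of the index space\<close>

text \<open>Functions on the index set \<^term>\<open>topspace \<tau>\<close> are represented by extensional functions,
  so that distinct members of \<open>unit_cfuns \<tau>\<close> are distinct as functions on the index set.\<close>

definition unit_cfuns :: "'t topology \<Rightarrow> ('t \<Rightarrow> real) set" where
  "unit_cfuns \<tau> = {\<phi> \<in> extensional (topspace \<tau>). continuous_map \<tau> (top_of_set {0..1}) \<phi>}"

definition cube :: "'t topology \<Rightarrow> (('t \<Rightarrow> real) \<Rightarrow> real) topology" where
  "cube \<tau> = product_topology (\<lambda>_. top_of_set {0..1}) (unit_cfuns \<tau>)"

definition eval_at :: "'t topology \<Rightarrow> 't \<Rightarrow> ('t \<Rightarrow> real) \<Rightarrow> real" where
  "eval_at \<tau> t = (\<lambda>\<phi>\<in>unit_cfuns \<tau>. \<phi> t)"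

definition compactification :: "'t topology \<Rightarrow> (('t \<Rightarrow> real) \<Rightarrow> real) set" where
  "compactification \<tau> = cube \<tau> closure_of (eval_at \<tau> ` topspace \<tau>)"


section \<open>Nets and upper limits\<close>

text \<open>A net in \<open>T\<close> is represented by its filter of tails, a proper filter on \<open>T\<close>. The lemmas of
  this section show that convergence and the upper limit of a net, over a directed set of any type,
  depend only on this filter, and that every proper filter on \<open>T\<close> is the filter of tails of a net.
  So a supremum over all nets in \<open>T\<close> is a supremum over all proper filters on \<open>T\<close>.\<close>

definition directed :: "'i set \<Rightarrow> ('i \<Rightarrow> 'i \<Rightarrow> bool) \<Rightarrow> bool" where
  "directed I le \<longleftrightarrow> I \<noteq> {} \<and> (\<forall>i\<in>I. le i i) \<and>
    (\<forall>i\<in>I. \<forall>j\<in>I. \<forall>k\<in>I. le i j \<longrightarrow> le j k \<longrightarrow> le i k) \<and>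
    (\<forall>i\<in>I. \<forall>j\<in>I. \<exists>k\<in>I. le i k \<and> le j k)"

definition tails :: "'i set \<Rightarrow> ('i \<Rightarrow> 'i \<Rightarrow> bool) \<Rightarrow> ('i \<Rightarrow> 't) \<Rightarrow> 't filter" where
  "tails I le s = (INF i\<in>I. principal (s ` {j\<in>I. le i j}))"

lemma eventually_tails:
  assumes "directed I le"
  shows "eventually P (tails I le s) \<longleftrightarrow> (\<exists>i\<in>I. \<forall>j\<in>I. le i j \<longrightarrow> P (s j))"
proof -
  have "eventually P (tails I le s) \<longleftrightarrow> (\<exists>i\<in>I. eventually P (principal (s ` {j\<in>I. le i j})))"
    unfolding tails_def
  proof (rule eventually_INF_base)
    show "I \<noteq> {}"
      using assms by (simp add: directed_def)
    fix i j assume ij: "i \<in> I" "j \<in> I"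
    then obtain k where k: "k \<in> I" "le i k" "le j k"
      using assms unfolding directed_def by blast
    have "{l\<in>I. le k l} \<subseteq> {l\<in>I. le i l}" "{l\<in>I. le k l} \<subseteq> {l\<in>I. le j l}"
      using assms ij k unfolding directed_def by blast+
    then show "\<exists>k\<in>I. principal (s ` {l\<in>I. le k l}) \<le>
        inf (principal (s ` {l\<in>I. le i l})) (principal (s ` {l\<in>I. le j l}))"
      using k(1) by (intro bexI[of _ k]) auto
  qed
  then show ?thesis
    by (auto simp: eventually_principal)
qed

lemma tails_neq_bot:
  assumes "directed I le"
  shows "tails I le s \<noteq> bot"
  using assms unfolding trivial_limit_def eventually_tails[OF assms] directed_def by blast

lemma tails_le_principal:
  assumes "directed I le" "s ` I \<subseteq> T"
  shows "tails I le s \<le> principal T"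
  using assms unfolding le_principal eventually_tails[OF assms(1)] directed_def by blast

lemma Limsup_tails:
  fixes g :: "'t \<Rightarrow> ereal"
  assumes "directed I le"
  shows "Limsup (tails I le s) g = (INF i\<in>I. SUP j\<in>{j\<in>I. le i j}. g (s j))"
proof (rule antisym)
  show "Limsup (tails I le s) g \<le> (INF i\<in>I. SUP j\<in>{j\<in>I. le i j}. g (s j))"
  proof (rule INF_greatest)
    fix i assume "i \<in> I"
    then have "eventually (\<lambda>t. t \<in> s ` {j\<in>I. le i j}) (tails I le s)"
      by (auto simp: eventually_tails[OF assms])
    then have "Limsup (tails I le s) g \<le> (SUP t\<in>{t. t \<in> s ` {j\<in>I. le i j}}. g t)"
      unfolding Limsup_def by (intro INF_lower) simp
    then show "Limsup (tails I le s) g \<le> (SUP j\<in>{j\<in>I. le i j}. g (s j))"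
      by (simp add: image_image)
  qed
  show "(INF i\<in>I. SUP j\<in>{j\<in>I. le i j}. g (s j)) \<le> Limsup (tails I le s) g"
    unfolding Limsup_def
  proof (rule INF_greatest)
    fix P assume "P \<in> {P. eventually P (tails I le s)}"
    then obtain i where i: "i \<in> I" "\<forall>j\<in>I. le i j \<longrightarrow> P (s j)"
      by (auto simp: eventually_tails[OF assms])
    show "(INF i\<in>I. SUP j\<in>{j\<in>I. le i j}. g (s j)) \<le> (SUP t\<in>{t. P t}. g t)"
      using i by (intro INF_lower2[OF i(1)] SUP_mono) auto
  qed
qed

lemma filter_eq_tails:
  fixes F :: "'t filter"
  assumes "F \<noteq> bot" "F \<le> principal T"
  obtains I :: "('t set \<times> 't) set" and le s
  where "directed I le" "s ` I \<subseteq> T" "F = tails I le s"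
proof -
  define I where "I = {(A, t). eventually (\<lambda>t. t \<in> A) F \<and> t \<in> A \<inter> T}"
  define le where "le = (\<lambda>(i :: 't set \<times> 't) (j :: 't set \<times> 't). fst j \<subseteq> fst i)"
  have T: "eventually (\<lambda>t. t \<in> T) F"
    using assms(2) by (simp add: le_principal)
  have ne: "\<exists>t. (A, t) \<in> I" if "eventually (\<lambda>t. t \<in> A) F" for A
    using eventually_happens'[OF assms(1) eventually_conj[OF that T]] that by (auto simp: I_def)
  have dir: "directed I le"
    unfolding directed_def
  proof (intro conjI ballI impI)
    show "I \<noteq> {}"
      using ne[OF T] by auto
  next
    fix i j assume "i \<in> I" "j \<in> I"
    then have "eventually (\<lambda>t. t \<in> fst i \<inter> fst j) F"
      by (auto simp: I_def eventually_conj)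
    from ne[OF this] obtain t where "(fst i \<inter> fst j, t) \<in> I" ..
    then show "\<exists>k\<in>I. le i k \<and> le j k"
      by (rule rev_bexI) (auto simp: le_def)
  qed (auto simp: le_def)
  have "eventually P F \<longleftrightarrow> eventually P (tails I le snd)" for P
    unfolding eventually_tails[OF dir]
  proof
    assume P: "eventually P F"
    then have "eventually (\<lambda>t. t \<in> Collect P) F"
      by simp
    from ne[OF this] obtain t where "(Collect P, t) \<in> I" ..
    then show "\<exists>i\<in>I. \<forall>j\<in>I. le i j \<longrightarrow> P (snd j)"
      by (rule rev_bexI) (auto simp: le_def I_def)
  next
    assume "\<exists>i\<in>I. \<forall>j\<in>I. le i j \<longrightarrow> P (snd j)"
    then obtain i where i: "i \<in> I" "\<And>j. j \<in> I \<Longrightarrow> le i j \<Longrightarrow> P (snd j)"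
      by blast
    have A: "eventually (\<lambda>t. t \<in> fst i) F"
      using i(1) by (auto simp: I_def)
    have "P t" if "t \<in> fst i" "t \<in> T" for t
      using i(2)[of "(fst i, t)"] A that by (auto simp: I_def le_def)
    with A T show "eventually P F"
      by (auto elim: eventually_elim2)
  qed
  then have "F = tails I le snd"
    by (simp add: filter_eq_iff)
  moreover have "snd ` I \<subseteq> T"
    by (auto simp: I_def)
  ultimately show thesis
    using dir that by blast
qed

text \<open>The nets \<open>(t\<^sub>i)\<close> in the index set whose evaluations converge to \<open>\<gamma>\<close>.\<close>

definition nets_to :: "'t topology \<Rightarrow> (('t \<Rightarrow> real) \<Rightarrow> real) \<Rightarrow> 't filter set" where
  "nets_to \<tau> \<gamma> =
    {F. F \<noteq> bot \<and> F \<le> principal (topspace \<tau>) \<and> limitin (cube \<tau>) (eval_at \<tau>) \<gamma> F}"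


section \<open>The supremum function and its active indices\<close>

definition sup_fun :: "'t topology \<Rightarrow> ('t \<Rightarrow> 'a \<Rightarrow> ereal) \<Rightarrow> 'a \<Rightarrow> ereal" where
  "sup_fun \<tau> f z = (SUP t\<in>topspace \<tau>. f t z)"

definition f_hat ::
    "'t topology \<Rightarrow> ('t \<Rightarrow> 'a \<Rightarrow> ereal) \<Rightarrow> (('t \<Rightarrow> real) \<Rightarrow> real) \<Rightarrow> 'a \<Rightarrow> ereal" where
  "f_hat \<tau> f \<gamma> z = (SUP F\<in>nets_to \<tau> \<gamma>. Limsup F (\<lambda>t. f t z))"

definition active ::
    "'t topology \<Rightarrow> ('t \<Rightarrow> 'a \<Rightarrow> ereal) \<Rightarrow> 'a \<Rightarrow> (('t \<Rightarrow> real) \<Rightarrow> real) set" where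
  "active \<tau> f x =
    (if \<bar>sup_fun \<tau> f x\<bar> \<noteq> \<infinity>
     then {\<gamma> \<in> compactification \<tau>. f_hat \<tau> f \<gamma> x \<ge> sup_fun \<tau> f x} else {})"

definition f_tilde ::
    "'t topology \<Rightarrow> ('t \<Rightarrow> 'a \<Rightarrow> ereal) \<Rightarrow> 'a \<Rightarrow> (('t \<Rightarrow> real) \<Rightarrow> real) \<Rightarrow> 'a \<Rightarrow> ereal" where
  "f_tilde \<tau> f x \<gamma> z =
    (SUP F\<in>{F \<in> nets_to \<tau> \<gamma>. ((\<lambda>t. f t x) \<longlongrightarrow> sup_fun \<tau> f x) F}. Limsup F (\<lambda>t. f t z))"

end

theory Submission
  imports Defs
begin

text \<open>Let \<open>\<phi> \<in> \<partial>f(x)\<close> and \<open>L\<close> be given, let \<open>n\<close> be the dimension of \<open>L\<close> (or the size of a spanning set), and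
  let \<open>D = L \<inter> dom f\<close>. For a finite set \<open>P \<subseteq> D\<close> and \<open>\<epsilon> > 0\<close>, Helly's theorem together with a convex
  alternative yields \<open>n + 1\<close> indices \<open>t\<^sub>i\<close> and weights \<open>a\<^sub>i\<close> with \<open>\<Sum>a\<^sub>i f\<^sub>t\<^sub>i \<ge> f(x) + \<phi>(\<cdot> - x) - \<epsilon>\<close> on \<open>P\<close>. The number
  of indices does not depend on \<open>P\<close>, so along an ultrafilter the weights converge and the \<open>t\<^sub>i\<close> converge to
  points \<open>\<gamma>\<^sub>i\<close> of the compactification. If the limit weight of \<open>t\<^sub>i\<close> is positive, then necessarily
  \<open>f\<^sub>t\<^sub>i(x) \<rightarrow> f(x)\<close>, so \<open>\<gamma>\<^sub>i\<close> is active, and the convex combination of the corresponding regularizations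
  \<open>f\<^sub>\<gamma>\<^sub>i\<close> (\<open>f_tilde\<close>) dominates \<open>f(x) + \<phi>(\<cdot> - x)\<close> on \<open>D\<close>. As all these functions are finite on \<open>D\<close>, whose
  relative core is nonempty, the sum rule splits \<open>\<phi>\<close> on \<open>L\<close> into a convex combination of their
  subgradients, which extend to continuous functionals by the Hahn--Banach theorem. The
  reverse inclusion follows from \<open>f\<^sub>\<gamma> \<le> f\<close>, taking \<open>L = span {x, y}\<close>.\<close>

section \<open>Ultrafilters\<close>

definition ultrafilter :: "'i filter \<Rightarrow> bool" where
  "ultrafilter U \<longleftrightarrow> U \<noteq> bot \<and> (\<forall>P. eventually P U \<or> eventually (\<lambda>x. \<not> P x) U)"

text \<open>Zorn's lemma gives a minimal proper filter below \<open>F\<close>: the infimum of a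
  chain is proper, since an event eventual in the infimum is already eventual in one member.
  Minimality decides every \<open>P\<close>, because a proper trace on \<open>P\<close> must be the
  whole filter.\<close>

lemma ultrafilter_exists:
  fixes F :: "'i filter"
  assumes "F \<noteq> bot"
  obtains U where "U \<le> F" "ultrafilter U"
proof -
  let ?A = "{G. G \<le> F \<and> G \<noteq> bot}"
  have "\<exists>m\<in>?A. \<forall>a\<in>?A. m \<ge> a \<longrightarrow> a = m"
  proof (rule predicate_Zorn)
    show "partial_order_on ?A (relation_of (\<ge>) ?A)"
      by (auto simp: partial_order_on_def preorder_on_def refl_on_def trans_def antisym_def relation_of_def)
    fix C assume C: "C \<in> Chains (relation_of (\<ge>) ?A)"
    then have sub: "C \<subseteq> ?A" and ch: "\<And>a b. a \<in> C \<Longrightarrow> b \<in> C \<Longrightarrow> a \<le> b \<or> b \<le> a"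
      by (auto simp: Chains_def relation_of_def)
    show "\<exists>u\<in>?A. \<forall>a\<in>C. a \<ge> u"
    proof (cases "C = {}")
      case True
      then show ?thesis using assms by auto
    next
      case False
      have "Inf C \<noteq> bot"
      proof
        assume "Inf C = bot"
        then have "eventually (\<lambda>_. False) (Inf C)" by simp
        then obtain b where "b \<in> C" "eventually (\<lambda>_. False) b"
          by (subst (asm) eventually_Inf_base[OF False]) (use ch in \<open>auto simp: inf_absorb1 inf_absorb2\<close>, meson ch order_refl)
        then show False using sub by (auto simp: trivial_limit_def)
      qed
      moreover have "Inf C \<le> F" using False sub by (auto intro: Inf_lower2)
      ultimately show ?thesis by (intro bexI[of _ "Inf C"]) (auto intro: Inf_lower)
    qed
  qed
  then obtain U where U: "U \<le> F" "U \<noteq> bot" and min: "\<And>G. G \<le> U \<Longrightarrow> G \<noteq> bot \<Longrightarrow> G = U"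
    by (auto intro: order_trans)
  have "eventually P U \<or> eventually (\<lambda>x. \<not> P x) U" for P
  proof (cases "inf U (principal {x. P x}) = bot")
    case True
    then have "eventually (\<lambda>x. \<not> P x) U"
      by (simp add: trivial_limit_def eventually_inf_principal)
    then show ?thesis ..
  next
    case False
    then have "inf U (principal {x. P x}) = U" by (intro min) auto
    then have "U \<le> principal {x. P x}" by (simp only: inf.absorb_iff1)
    then show ?thesis by (simp add: le_principal)
  qed
  with U that show thesis unfolding ultrafilter_def by blast
qed

text \<open>Compactness gives a cluster point of the image filter. An ultrafilter that is not
  eventually in a neighbourhood is eventually outside it, so it converges to each cluster
  point.\<close>

lemma ultrafilter_converges:
  fixes g :: "'i \<Rightarrow> 'b::topological_space"
  assumes U: "ultrafilter U"
    and K: "compact K" "eventually (\<lambda>i. g i \<in> K) U"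
  shows "\<exists>l\<in>K. (g \<longlongrightarrow> l) U"
proof -
  have "filtermap g U \<le> principal K" "filtermap g U \<noteq> bot"
    using U K(2) by (auto simp: ultrafilter_def le_principal eventually_filtermap filtermap_bot_iff)
  then obtain l where l: "l \<in> K" "inf (nhds l) (filtermap g U) \<noteq> bot"
    using K(1) unfolding compact_filter le_principal by blast
  have "(g \<longlongrightarrow> l) U"
  proof (rule topological_tendstoI)
    fix S assume S: "open S" "l \<in> S"
    show "eventually (\<lambda>i. g i \<in> S) U"
    proof (rule ccontr)
      assume "\<not> ?thesis"
      then have "eventually (\<lambda>y. y \<notin> S) (filtermap g U)"
        using U by (auto simp: ultrafilter_def eventually_filtermap)
      moreover have "eventually (\<lambda>y. y \<in> S) (nhds l)" using S by (auto simp: eventually_nhds)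
      ultimately have "eventually (\<lambda>_. False) (inf (nhds l) (filtermap g U))"
        unfolding eventually_inf by blast
      then show False using l(2) by (simp add: trivial_limit_def)
    qed
  qed
  with l(1) show ?thesis by blast
qed

section \<open>Hahn--Banach theorems\<close>

text \<open>Homogeneity is asked as an inequality for positive factors, the form that is easiest to
  check for infima. Equality follows with the inverse factor, and \<open>p 0 = 0\<close> from the
  factors 2 and 1/2.\<close>

definition sublin :: "('b::real_vector \<Rightarrow> real) \<Rightarrow> bool" where
  "sublin p \<longleftrightarrow> (\<forall>x y. p (x + y) \<le> p x + p y) \<and> (\<forall>a>0. \<forall>x. p (a *\<^sub>R x) \<le> a * p x)"

lemma sublinD:
  assumes "sublin p"
  shows "p (x + y) \<le> p x + p y" "a > 0 \<Longrightarrow> p (a *\<^sub>R x) = a * p x" "p 0 = 0" "- p (- x) \<le> p x"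
proof -
  show add: "p (x + y) \<le> p x + p y" for x y using assms by (simp add: sublin_def)
  have le: "p (a *\<^sub>R x) \<le> a * p x" if "a > 0" for a x using assms that by (simp add: sublin_def)
  show "p (a *\<^sub>R x) = a * p x" if "a > 0"
  proof (rule antisym[OF le[OF that]])
    have "p (inverse a *\<^sub>R a *\<^sub>R x) \<le> inverse a * p (a *\<^sub>R x)" using that by (intro le) simp
    then show "a * p x \<le> p (a *\<^sub>R x)" using that by (simp add: field_simps)
  qed
  show p0: "p 0 = 0"
    using le[of 2 0] le[of "1/2" 0] by simp
  show "- p (- x) \<le> p x"
    using add[of x "- x"] p0 by simp
qed

text \<open>For fixed \<open>v\<close>, the infimum over \<open>s \<ge> 0\<close> of
  \<open>q (y + s *\<^sub>R v) - s * q v\<close> is sublinear and below \<open>q\<close>, hence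
  equal to \<open>q\<close>. The choice \<open>s = 1\<close> then gives superadditivity.\<close>

lemma minimal_sublin_linear:
  fixes q :: "'b::real_vector \<Rightarrow> real"
  assumes q: "sublin q" and min: "\<And>r. sublin r \<Longrightarrow> r \<le> q \<Longrightarrow> r = q"
  shows "linear q"
proof -
  have ge: "q (y + v) \<ge> q y + q v" for y v
  proof -
    define S where "S = (\<lambda>y. {q (y + s *\<^sub>R v) - s * q v | s. s \<ge> 0})"
    define r where "r = (\<lambda>y. Inf (S y))"
    have qs: "q (s *\<^sub>R v) = s * q v" if "s \<ge> 0" for s
      using sublinD(2,3)[OF q] that by (cases "s = 0") auto
    have lb: "- q (- y) \<le> t" if "t \<in> S y" for t y
    proof -
      obtain s where s: "s \<ge> 0" "t = q (y + s *\<^sub>R v) - s * q v" using \<open>t \<in> S y\<close> by (auto simp: S_def)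
      have "q (s *\<^sub>R v) \<le> q (y + s *\<^sub>R v) + q (- y)"
        using sublinD(1)[OF q, of "y + s *\<^sub>R v" "- y"] by simp
      then show ?thesis using qs[OF s(1)] s(2) by simp
    qed
    have ne: "S y \<noteq> {}" for y by (auto simp: S_def)
    have bdd: "bdd_below (S y)" for y using lb by (rule bdd_belowI)
    have up: "r y \<le> q (y + s *\<^sub>R v) - s * q v" if "s \<ge> 0" for y s
      unfolding r_def using that by (intro cInf_lower bdd) (auto simp: S_def)
    have r_q: "r \<le> q" using up[of 0] by (simp add: le_fun_def)
    have "sublin r"
      unfolding sublin_def
    proof (intro conjI allI impI)
      fix x y
      have *: "r (x + y) \<le> t + u" if tu: "t \<in> S x" "u \<in> S y" for t u
      proof -
        obtain s where "s \<ge> 0" "t = q (x + s *\<^sub>R v) - s * q v" using tu(1) by (auto simp: S_def)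
        moreover obtain s' where "s' \<ge> 0" "u = q (y + s' *\<^sub>R v) - s' * q v" using tu(2) by (auto simp: S_def)
        ultimately have s: "s \<ge> 0" "t = q (x + s *\<^sub>R v) - s * q v" "s' \<ge> 0" "u = q (y + s' *\<^sub>R v) - s' * q v"
          by blast+
        have "r (x + y) \<le> q ((x + y) + (s + s') *\<^sub>R v) - (s + s') * q v"
          using s by (intro up) simp
        also have "(x + y) + (s + s') *\<^sub>R v = (x + s *\<^sub>R v) + (y + s' *\<^sub>R v)" by (simp add: algebra_simps)
        also have "q \<dots> \<le> q (x + s *\<^sub>R v) + q (y + s' *\<^sub>R v)" by (rule sublinD(1)[OF q])
        finally show ?thesis using s by (simp add: algebra_simps)
      qed
      have "r (x + y) - u \<le> r x" if "u \<in> S y" for u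
        using *[OF _ that] unfolding r_def[of] by (intro cInf_greatest ne) (simp add: algebra_simps)
      then have "r (x + y) - r x \<le> u" if "u \<in> S y" for u using that by (simp add: algebra_simps)
      then have "r (x + y) - r x \<le> r y" unfolding r_def by (intro cInf_greatest ne)
      then show "r (x + y) \<le> r x + r y" by simp
    next
      fix a :: real and x assume a: "a > 0"
      have "r (a *\<^sub>R x) / a \<le> t" if tS: "t \<in> S x" for t
      proof -
        obtain s where s: "s \<ge> 0" "t = q (x + s *\<^sub>R v) - s * q v" using tS by (auto simp: S_def)
        have "r (a *\<^sub>R x) \<le> q (a *\<^sub>R x + (a * s) *\<^sub>R v) - (a * s) * q v"
          using s a by (intro up) simp
        also have "a *\<^sub>R x + (a * s) *\<^sub>R v = a *\<^sub>R (x + s *\<^sub>R v)" by (simp add: algebra_simps)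
        also have "q \<dots> = a * q (x + s *\<^sub>R v)" using a by (rule sublinD(2)[OF q])
        finally show ?thesis using a unfolding s(2) by (simp add: field_simps)
      qed
      then have "r (a *\<^sub>R x) / a \<le> r x" unfolding r_def[of] by (intro cInf_greatest ne)
      then show "r (a *\<^sub>R x) \<le> a * r x" using a by (simp add: field_simps)
    qed
    then have "r = q" using r_q by (rule min)
    then show ?thesis using up[of 1 y] by simp
  qed
  have add: "q (x + y) = q x + q y" for x y
    using ge[of x y] sublinD(1)[OF q, of x y] by simp
  have neg: "q (- x) = - q x" for x
    using add[of x "- x"] sublinD(3)[OF q] by simp
  have "q (a *\<^sub>R x) = a * q x" for a x
  proof (cases a "0::real" rule: linorder_cases)
    case less
    then have "q (- ((- a) *\<^sub>R x)) = a * q x" unfolding neg using sublinD(2)[OF q, of "- a" x] by simp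
    then show ?thesis by simp
  qed (use sublinD[OF q] in auto)
  with add show ?thesis by (intro linearI) auto
qed

text \<open>Zorn's lemma among the sublinear functionals below \<open>p\<close>, whose minimal
  elements are linear. Infima of chains are finite because every member is at least
  \<open>- p (- x)\<close>, and subadditive because the smaller of two members serves both
  arguments.\<close>

theorem Hahn_Banach_sublinear:
  fixes p :: "'b::real_vector \<Rightarrow> real"
  assumes p: "sublin p"
  shows "\<exists>l. linear l \<and> (\<forall>x. l x \<le> p x)"
proof -
  let ?A = "{q. sublin q \<and> q \<le> p}"
  have "\<exists>m\<in>?A. \<forall>a\<in>?A. m \<ge> a \<longrightarrow> a = m"
  proof (rule predicate_Zorn)
    show "partial_order_on ?A (relation_of (\<ge>) ?A)"
      by (auto simp: partial_order_on_def preorder_on_def refl_on_def trans_def antisym_def relation_of_def)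
    fix C assume C: "C \<in> Chains (relation_of (\<ge>) ?A)"
    then have sub: "\<And>q. q \<in> C \<Longrightarrow> sublin q" "\<And>q x. q \<in> C \<Longrightarrow> q x \<le> p x"
      and ch: "\<And>a b. a \<in> C \<Longrightarrow> b \<in> C \<Longrightarrow> a \<le> b \<or> b \<le> a"
      by (auto simp: Chains_def relation_of_def le_fun_def)
    show "\<exists>u\<in>?A. \<forall>a\<in>C. a \<ge> u"
    proof (cases "C = {}")
      case True
      then show ?thesis using p by auto
    next
      case False
      define u where "u = (\<lambda>x. INF q\<in>C. q x)"
      have "- p (- x) \<le> q x" if "q \<in> C" for q x
        using sublinD(4)[OF sub(1)[OF that], of x] sub(2)[OF that, of "- x"] by simp
      then have bdd: "bdd_below ((\<lambda>q. q x) ` C)" for x by (auto intro!: bdd_belowI)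
      have low: "u x \<le> q x" if "q \<in> C" for q x
        unfolding u_def using that bdd by (intro cINF_lower) auto
      have gr: "b \<le> u x" if "\<And>q. q \<in> C \<Longrightarrow> b \<le> q x" for b x
        unfolding u_def using that False by (intro cINF_greatest)
      have "sublin u"
        unfolding sublin_def
      proof (intro conjI allI impI)
        fix x y
        have *: "u (x + y) \<le> q x + q' y" if q: "q \<in> C" "q' \<in> C" for q q'
        proof -
          obtain m where m: "m \<in> C" "m \<le> q" "m \<le> q'" using ch[OF q] q by blast
          have "u (x + y) \<le> m (x + y)" by (rule low[OF m(1)])
          also have "\<dots> \<le> m x + m y" by (rule sublinD(1)[OF sub(1)[OF m(1)]])
          finally show ?thesis using le_funD[OF m(2), of x] le_funD[OF m(3), of y] by simp
        qed
        have "u (x + y) - q' y \<le> u x" if "q' \<in> C" for q'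
          using * that by (intro gr) (simp add: algebra_simps)
        then have "u (x + y) - u x \<le> u y" by (intro gr) (simp add: algebra_simps)
        then show "u (x + y) \<le> u x + u y" by simp
      next
        fix a :: real and x assume a: "a > 0"
        have "u (a *\<^sub>R x) / a \<le> u x"
        proof (rule gr)
          fix q assume "q \<in> C"
          then show "u (a *\<^sub>R x) / a \<le> q x"
            using low[of q "a *\<^sub>R x"] sublinD(2)[OF sub(1) a, of q x] a by (simp add: field_simps)
        qed
        then show "u (a *\<^sub>R x) \<le> a * u x" using a by (simp add: field_simps)
      qed
      moreover have "u \<le> p" using False low sub(2) unfolding le_fun_def by (meson all_not_in_conv order_trans)
      ultimately show ?thesis using low by (intro bexI[of _ u]) (auto simp: le_fun_def)
    qed
  qed
  then obtain m where m: "sublin m" "m \<le> p" "\<And>r. sublin r \<Longrightarrow> r \<le> m \<Longrightarrow> r = m"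
    by (auto intro: order_trans)
  show ?thesis
    using minimal_sublin_linear[OF m(1,3)] m(2) by (auto simp: le_fun_def)
qed

text \<open>The gauge \<open>p\<close> of the cone generated by \<open>K\<close> is finite by absorption and sublinear by convexity.\<close>

theorem Hahn_Banach_convex_set:
  fixes K :: "('b::real_vector \<times> real) set"
  assumes K: "convex K" and pos: "\<And>r. (0, r) \<in> K \<Longrightarrow> 0 \<le> r"
    and absorb: "\<And>w. \<exists>s>0. \<exists>r. (s *\<^sub>R w, r) \<in> K"
  shows "\<exists>l. linear l \<and> (\<forall>w r. (w, r) \<in> K \<longrightarrow> l w \<le> r)"
proof -
  \<comment> \<open>These are the heights over \<open>w\<close> in the cone generated by
    \<open>K\<close>.\<close>
  define S where "S = (\<lambda>w. {a * r | a r. a > 0 \<and> (inverse a *\<^sub>R w, r) \<in> K})"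
  define p where "p = (\<lambda>w. Inf (S w))"
  have S_I: "t \<in> S w" if "a > 0" "(inverse a *\<^sub>R w, r) \<in> K" "t = a * r" for a r t w
    unfolding S_def using that by blast
  have S_add: "t + u \<in> S (v + w)" if tu: "t \<in> S v" "u \<in> S w" for t u v w
  proof -
    obtain a r b s where a: "a > 0" "(inverse a *\<^sub>R v, r) \<in> K" "t = a * r"
      and b: "b > 0" "(inverse b *\<^sub>R w, s) \<in> K" "u = b * s"
      using tu by (auto simp: S_def)
    \<comment> \<open>The weights are chosen so that the combination is the sum rescaled by the
      common factor \<open>inverse (a + b)\<close>.\<close>
    have "(a / (a + b)) *\<^sub>R (inverse a *\<^sub>R v, r) + (b / (a + b)) *\<^sub>R (inverse b *\<^sub>R w, s) \<in> K"
      using a b by (intro convexD[OF K]) (auto simp: add_divide_distrib[symmetric])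
    also have "(a / (a + b)) *\<^sub>R (inverse a *\<^sub>R v, r) + (b / (a + b)) *\<^sub>R (inverse b *\<^sub>R w, s)
      = (inverse (a + b) *\<^sub>R (v + w), inverse (a + b) * (t + u))"
    proof -
      have "a / (a + b) * inverse a = inverse (a + b)" "b / (a + b) * inverse b = inverse (a + b)"
        using a(1) b(1) by (simp_all add: field_simps)
      moreover have "a / (a + b) * r + b / (a + b) * s = inverse (a + b) * (a * r + b * s)"
        by (simp only: divide_inverse distrib_left mult_ac)
      ultimately show ?thesis
        unfolding a(3) b(3) by (simp only: scaleR_Pair add_Pair scaleR_scaleR scaleR_add_right real_scaleR_def)
    qed
    finally have *: "(inverse (a + b) *\<^sub>R (v + w), inverse (a + b) * (t + u)) \<in> K" .
    have "x = c * (inverse c * x)" if "c \<noteq> 0" for c x :: real using that by simp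
    from this[of "a + b" "t + u"] have "t + u = (a + b) * (inverse (a + b) * (t + u))"
      using a(1) b(1) by linarith
    then show ?thesis using a(1) b(1) * by (intro S_I[of "a + b"]) auto
  qed
  have S_scale: "a * t \<in> S (a *\<^sub>R w)" if at: "a > 0" "t \<in> S w" for a t w
  proof -
    obtain b r where b: "b > 0" "(inverse b *\<^sub>R w, r) \<in> K" "t = b * r" using at by (auto simp: S_def)
    have "inverse (a * b) * a = inverse b" using at(1) by simp
    then have "inverse (a * b) *\<^sub>R (a *\<^sub>R w) = inverse b *\<^sub>R w" by (simp only: scaleR_scaleR)
    with b(2) have "(inverse (a * b) *\<^sub>R (a *\<^sub>R w), r) \<in> K" by (simp only:)
    from S_I[OF _ this, of "a * t"] show ?thesis using at(1) b by simp
  qed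
  have S0: "0 \<le> t" if t0: "t \<in> S 0" for t
  proof -
    obtain a r where "a > 0" "(0, r) \<in> K" "t = a * r" using t0 by (auto simp: S_def)
    then show ?thesis using pos[of r] by simp
  qed
  have ne: "S w \<noteq> {}" for w
  proof -
    obtain s r where "s > 0" "(s *\<^sub>R w, r) \<in> K" using absorb by blast
    then have "inverse s * r \<in> S w" by (intro S_I[of "inverse s" _ r]) simp_all
    then show ?thesis by blast
  qed
  have bdd: "bdd_below (S w)" for w
  proof -
    obtain u where u: "u \<in> S (- w)" using ne by blast
    have "- u \<le> t" if "t \<in> S w" for t using S0[of "t + u"] S_add[OF that u] by simp
    then show ?thesis by (rule bdd_belowI)
  qed
  have up: "p w \<le> t" if "t \<in> S w" for t w unfolding p_def using that bdd by (rule cInf_lower)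
  have gr: "b \<le> p w" if "\<And>t. t \<in> S w \<Longrightarrow> b \<le> t" for b w unfolding p_def using ne that by (rule cInf_greatest)
  have "sublin p"
    unfolding sublin_def
  proof (intro conjI allI impI)
    fix x y
    have "p (x + y) - u \<le> p x" if "u \<in> S y" for u
      using up[OF S_add[OF _ that]] by (intro gr) (simp add: algebra_simps)
    then have "p (x + y) - p x \<le> p y" by (intro gr) (simp add: algebra_simps)
    then show "p (x + y) \<le> p x + p y" by simp
  next
    fix a :: real and x assume a: "a > 0"
    have "p (a *\<^sub>R x) / a \<le> p x"
      using up[OF S_scale[OF a]] a by (intro gr) (simp add: field_simps)
    then show "p (a *\<^sub>R x) \<le> a * p x" using a by (simp add: field_simps)
  qed
  then obtain l where l: "linear l" "\<And>x. l x \<le> p x" using Hahn_Banach_sublinear by blast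
  have "l w \<le> r" if "(w, r) \<in> K" for w r
  proof -
    have "r \<in> S w" using that by (intro S_I[of 1 _ r]) simp_all
    then show ?thesis using l(2)[of w] up[of r w] by simp
  qed
  with l(1) show ?thesis by blast
qed

lemma sum_apply: "(\<Sum>i\<in>I. F i) x = (\<Sum>i\<in>I. F i x)" for F :: "'i \<Rightarrow> 'j \<Rightarrow> 'b::comm_monoid_add"
  by (induction I rule: infinite_finite_induct) auto

text \<open>Hahn--Banach is applied to the convex function sending \<open>w\<close> to the infimum
  over \<open>y \<in> Q\<close> of the maximum of \<open>y i - w i\<close>; \<open>K\<close> is its
  epigraph up to the boundary, and \<open>neg\<close> makes it nonnegative at 0. The weights are the
  negated values of the functional at the unit vectors.\<close>

theorem convex_alternative:
  fixes Q :: "('i \<Rightarrow> real) set"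
  assumes I: "finite I" and Q: "convex Q" "Q \<noteq> {}"
    and neg: "\<And>y. y \<in> Q \<Longrightarrow> \<exists>i\<in>I. 0 \<le> y i"
  shows "\<exists>a. (\<forall>i\<in>I. 0 \<le> a i) \<and> sum a I = 1 \<and> (\<forall>y\<in>Q. 0 \<le> (\<Sum>i\<in>I. a i * y i))"
proof -
  define K where "K = {(w :: 'i \<Rightarrow> real, r). \<exists>y\<in>Q. \<forall>i\<in>I. y i \<le> w i + r}"
  have "convex K"
    unfolding convex_def
  proof (intro ballI allI impI)
    fix p q and u v :: real
    assume pq: "p \<in> K" "q \<in> K" and uv: "0 \<le> u" "0 \<le> v" "u + v = 1"
    obtain w r y where p: "p = (w, r)" "y \<in> Q" "\<And>i. i \<in> I \<Longrightarrow> y i \<le> w i + r" using pq by (auto simp: K_def)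
    obtain w' r' y' where q: "q = (w', r')" "y' \<in> Q" "\<And>i. i \<in> I \<Longrightarrow> y' i \<le> w' i + r'"
      using pq by (auto simp: K_def)
    have "u *\<^sub>R y + v *\<^sub>R y' \<in> Q" using convexD[OF Q(1)] p q uv by blast
    moreover have "(u *\<^sub>R y + v *\<^sub>R y') i \<le> (u *\<^sub>R w + v *\<^sub>R w') i + (u * r + v * r')" if "i \<in> I" for i
      using mult_left_mono[OF p(3)[OF that] uv(1)] mult_left_mono[OF q(3)[OF that] uv(2)]
      by (simp add: scaleR_fun_def algebra_simps)
    ultimately show "u *\<^sub>R p + v *\<^sub>R q \<in> K" unfolding K_def p(1) q(1)
      by (auto simp del: plus_fun_apply)
  qed
  moreover have "0 \<le> r" if "(0, r) \<in> K" for r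
  proof -
    obtain y where y: "y \<in> Q" "\<And>i. i \<in> I \<Longrightarrow> y i \<le> r" using \<open>(0, r) \<in> K\<close> by (auto simp: K_def)
    with neg[OF y(1)] show ?thesis by force
  qed
  moreover obtain y0 where y0: "y0 \<in> Q" using Q by blast
  have big: "\<exists>r. (w, r) \<in> K" for w
  proof -
    have "y0 i \<le> w i + (\<Sum>j\<in>I. \<bar>y0 j - w j\<bar>)" if "i \<in> I" for i
      using member_le_sum[OF that, of "\<lambda>j. \<bar>y0 j - w j\<bar>"] I by force
    then show ?thesis using y0 unfolding K_def by auto
  qed
  then have "\<exists>s>0. \<exists>r. (s *\<^sub>R w, r) \<in> K" for w by (intro exI[of _ 1]) auto
  ultimately obtain l where l: "linear l" "\<And>w r. (w, r) \<in> K \<Longrightarrow> l w \<le> r"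
    using Hahn_Banach_convex_set[of K] by blast
  define e where "e = (\<lambda>(i::'i) (j::'i). if j = i then 1 else 0::real)"
  define a where "a = (\<lambda>i. - l (e i))"
  \<comment> \<open>The type \<open>'i\<close> may be infinite, so \<open>l\<close> is evaluated
    only at functions vanishing off \<open>I\<close>, which are finite combinations of the
    \<open>e i\<close>.\<close>
  have lsum: "l (\<lambda>i. if i \<in> I then w i else 0) = - (\<Sum>i\<in>I. a i * w i)" for w
  proof -
    have "(\<lambda>i. if i \<in> I then w i else 0) = (\<Sum>i\<in>I. w i *\<^sub>R e i)"
      using I by (simp add: fun_eq_iff sum_apply e_def scaleR_fun_def if_distrib cong: if_cong)
    then show ?thesis
      by (simp add: linear_sum[OF l(1)] linear_scale[OF l(1)] a_def sum_negf mult.commute)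
  qed
  have a0: "0 \<le> a i" if "i \<in> I" for i
  proof (rule ccontr)
    assume "\<not> 0 \<le> a i"
    then have li: "l (e i) > 0" by (simp add: a_def)
    obtain r where r: "(0, r) \<in> K" using big by blast
    define s where "s = (\<bar>r\<bar> + 1) / l (e i)"
    have s: "s > 0" "s * l (e i) > r" using li by (auto simp: s_def)
    obtain y where y: "y \<in> Q" "\<And>i. i \<in> I \<Longrightarrow> y i \<le> r" using r by (auto simp: K_def)
    have "y j \<le> (s *\<^sub>R e i) j + r" if "j \<in> I" for j
      using y(2)[OF that] s(1) by (auto simp: scaleR_fun_def e_def)
    then have "(s *\<^sub>R e i, r) \<in> K" unfolding K_def using y(1) by (intro CollectI case_prodI bexI[of _ y] ballI)
    from l(2)[OF this] show False using s by (simp add: linear_scale[OF l(1)])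
  qed
  \<comment> \<open>Since \<open>r\<close> ranges over all reals, its coefficients on the two sides
    must agree, which gives \<open>sum a I = 1\<close>; the case \<open>r = 0\<close> is the claimed
    inequality.\<close>
  have key: "r * sum a I - (\<Sum>i\<in>I. a i * y i) \<le> r" if "y \<in> Q" for r y
  proof -
    have "((\<lambda>i. if i \<in> I then y i - r else 0), r) \<in> K"
      unfolding K_def using that by (intro CollectI case_prodI bexI[of _ y]) simp_all
    from l(2)[OF this] have "- (\<Sum>i\<in>I. a i * (y i - r)) \<le> r" unfolding lsum .
    then show ?thesis by (simp add: right_diff_distrib sum_subtractf sum_distrib_left mult.commute)
  qed
  have a1: "sum a I = 1"
  proof (rule ccontr)
    assume ne: "sum a I \<noteq> 1"
    define c where "c = (\<Sum>i\<in>I. a i * y0 i)"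
    have "r * (sum a I - 1) \<le> c" for r using key[OF y0, of r] by (simp add: c_def algebra_simps)
    from this[of "(c + 1) / (sum a I - 1)"] show False using ne by simp
  qed
  have "0 \<le> (\<Sum>i\<in>I. a i * y i)" if "y \<in> Q" for y using key[OF that, of 0] by simp
  with a0 a1 show ?thesis by (intro exI[of _ a]) simp
qed

section \<open>Helly's theorem and a minimax theorem\<close>

text \<open>Induction on \<open>J\<close>: the family without \<open>t\<close> has a common point
  \<open>X t\<close>. If two of these points coincide, their common value lies in every set.
  Otherwise they are more than \<open>card B + 1\<close> points of \<open>span B\<close>, hence
  affinely dependent, and a Radon point of them is common to all sets.\<close>

theorem Helly_indexed:
  fixes C :: "'t \<Rightarrow> 'b::real_vector set"
  assumes B: "finite B"
    and J: "finite J" "J \<noteq> {}"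
    and conv: "\<And>t. t \<in> J \<Longrightarrow> convex (C t)"
    and span: "\<And>t. t \<in> J \<Longrightarrow> C t \<subseteq> span B"
    and small: "\<And>J'. J' \<subseteq> J \<Longrightarrow> J' \<noteq> {} \<Longrightarrow> card J' \<le> card B + 1 \<Longrightarrow> (\<Inter>t\<in>J'. C t) \<noteq> {}"
  shows "(\<Inter>t\<in>J. C t) \<noteq> {}"
  using J conv span small
proof (induction J rule: finite_psubset_induct)
  case (psubset J)
  show ?case
  proof (cases "card J \<le> card B + 1")
    case True
    then show ?thesis using psubset.prems(1,4) by blast
  next
    case False
    have two: "\<exists>s\<in>J. s \<noteq> t" for t
    proof (rule ccontr)
      assume "\<not> ?thesis"
      then have "J \<subseteq> {t}" by blast
      then show False using False card_mono[of "{t}" J] by simp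
    qed
    have "(\<Inter>s\<in>J - {t}. C s) \<noteq> {}" if "t \<in> J" for t
    proof (rule psubset.IH)
      show "J - {t} \<subset> J" using that by blast
      show "J - {t} \<noteq> {}" using two[of t] by blast
      show "(\<Inter>s\<in>J'. C s) \<noteq> {}" if "J' \<subseteq> J - {t}" "J' \<noteq> {}" "card J' \<le> card B + 1" for J'
        using psubset.prems(4)[of J'] that by blast
    qed (use psubset.prems in auto)
    then have "\<exists>y. \<forall>s\<in>J - {t}. y \<in> C s" if "t \<in> J" for t using that by fastforce
    then obtain X where X: "\<And>t s. t \<in> J \<Longrightarrow> s \<in> J \<Longrightarrow> s \<noteq> t \<Longrightarrow> X t \<in> C s"
      by (metis Diff_iff singletonD)
    show ?thesis
    proof (cases "inj_on X J")
      case False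
      then obtain s t where st: "s \<in> J" "t \<in> J" "s \<noteq> t" "X s = X t" unfolding inj_on_def by blast
      have "X s \<in> C r" if "r \<in> J" for r
        using X[OF st(1) that] X[OF st(2) that] st by (cases "r = s") auto
      then show ?thesis by blast
    next
      case True
      obtain a where a: "a \<in> X ` J" using psubset.prems(1) by blast
      \<comment> \<open>Moving one point to the origin leaves more than \<open>card B\<close>
        nonzero vectors in \<open>span B\<close>, too many to be independent.\<close>
      let ?S = "(+) (- a) ` (X ` J - {a})"
      have XB: "X t \<in> span B" if t: "t \<in> J" for t
      proof -
        obtain s where "s \<in> J" "s \<noteq> t" using two by blast
        then show ?thesis using X[OF t, of s] psubset.prems(3) by blast
      qed
      have "dependent ?S"
      proof (rule ccontr)
        assume ind: "independent ?S"
        have "?S \<subseteq> span B"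
          using a by (auto intro!: span_diff XB)
        then have "card ?S \<le> card B" using independent_span_bound[OF B ind] by blast
        moreover have "card ?S = card (X ` J) - 1"
          using a psubset.hyps by (subst card_image) auto
        ultimately show False using False card_image[OF True] by simp
      qed
      then have "affine_dependent (X ` J)" using affine_dependent_iff_dependent2[OF a] by blast
      then obtain M P where MP: "M \<inter> P = {}" "M \<union> P = X ` J" "convex hull M \<inter> convex hull P \<noteq> {}"
        using Radon_partition[of "X ` J"] psubset.hyps by blast
      then obtain y where y: "y \<in> convex hull M" "y \<in> convex hull P" by blast
      \<comment> \<open>Only \<open>X s\<close> may lie outside \<open>C s\<close>, so the Radon
        part that avoids \<open>X s\<close> is contained in \<open>C s\<close>.\<close>
      have "y \<in> C s" if s: "s \<in> J" for s
      proof (cases "X s \<in> M")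
        case True
        have "P \<subseteq> C s"
        proof
          fix r assume r: "r \<in> P"
          then obtain t where t: "t \<in> J" "r = X t" using MP(2) by blast
          moreover have "s \<noteq> t" using r t True MP(1) by blast
          ultimately show "r \<in> C s" using X s by blast
        qed
        then have "convex hull P \<subseteq> C s" using psubset.prems(2)[OF s] by (rule hull_minimal)
        with y show ?thesis by blast
      next
        case False
        have "M \<subseteq> C s"
        proof
          fix r assume r: "r \<in> M"
          then obtain t where t: "t \<in> J" "r = X t" using MP(2) by blast
          moreover have "s \<noteq> t" using r t False MP(1) by blast
          ultimately show "r \<in> C s" using X s by blast
        qed
        then have "convex hull M \<subseteq> C s" using psubset.prems(2)[OF s] by (rule hull_minimal)
        with y show ?thesis by blast
      qed
      then show ?thesis by blast
    qed
  qed
qed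

text \<open>In \<open>finite_minimax\<close> the space carries no topology; limits of barycenters
  are compared through the values of linear functionals.\<close>

lemma linear_functionals_separate:
  fixes v w :: "'b::real_vector"
  assumes "\<And>l::'b \<Rightarrow> real. linear l \<Longrightarrow> l v = l w"
  shows "v = w"
proof (rule ccontr)
  assume "v \<noteq> w"
  then have "independent {v - w}" by simp
  then obtain l :: "'b \<Rightarrow> real" where l: "linear l" "l (v - w) = 1"
    using linear_independent_extend[of "{v - w}" "\<lambda>_. 1"] by auto
  then show False using assms[OF l(1)] by (simp add: linear_diff)
qed

text \<open>If every selection of at most \<open>card B + 1\<close> functions fails, the alternative shows that the convex
  sets \<open>C t\<close> of those barycenters of \<open>P\<close> at which the upper envelope of \<open>h t\<close> over \<open>P\<close> is at most \<open>c\<close>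
  satisfy the hypothesis of Helly's theorem. They are compact, so a single point lies in all of
  them, and by convexity it contradicts \<open>gt\<close>.\<close>

theorem finite_minimax:
  fixes h :: "'t \<Rightarrow> 'b::real_vector \<Rightarrow> real"
  assumes B: "finite B" "D \<subseteq> span B"
    and h: "\<And>t. t \<in> T \<Longrightarrow> convex_on D (h t)"
    and gt: "\<And>z. z \<in> D \<Longrightarrow> \<exists>t\<in>T. c < h t z"
    and P: "finite P" "P \<subseteq> D" "P \<noteq> {}"
  shows "\<exists>s a. (\<forall>i\<le>card B. s i \<in> T \<and> 0 \<le> a i) \<and> sum a {..card B} = 1 \<and>
    (\<forall>z\<in>P. c \<le> (\<Sum>i\<le>card B. a i * h (s i) z))"
proof (rule ccontr)
  assume contra: "\<not> ?thesis"
  define n where "n = card B"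
  define C where "C = (\<lambda>t. {\<Sum>z\<in>P. m z *\<^sub>R z | m. (\<forall>z\<in>P. 0 \<le> m z) \<and> sum m P = 1 \<and> (\<Sum>z\<in>P. m z * h t z) \<le> c})"
  have C_iff: "w \<in> C t \<longleftrightarrow> (\<exists>m. w = (\<Sum>z\<in>P. m z *\<^sub>R z) \<and> (\<forall>z\<in>P. 0 \<le> m z) \<and> sum m P = 1 \<and> (\<Sum>z\<in>P. m z * h t z) \<le> c)" for w t
    by (simp only: C_def mem_Collect_eq)
  have C_I: "(\<Sum>z\<in>P. m z *\<^sub>R z) \<in> C t"
    if "\<And>z. z \<in> P \<Longrightarrow> 0 \<le> m z" "sum m P = 1" "(\<Sum>z\<in>P. m z * h t z) \<le> c" for m t
    unfolding C_iff using that by (intro exI[of _ m]) simp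
  obtain t0 where t0: "t0 \<in> T" using gt P by blast
  have convD: "convex D" using h[OF t0] by (simp add: convex_on_def)
  have small: "(\<Inter>t\<in>J. C t) \<noteq> {}" if J: "finite J" "J \<subseteq> T" "J \<noteq> {}" "card J \<le> card B + 1" for J
  proof -
    obtain b where b: "bij_betw b {0..<card J} J" using ex_bij_betw_nat_finite[OF J(1)] by blast
    \<comment> \<open>The negated goal speaks of exactly \<open>card B + 1\<close> indices, so a
      shorter enumeration of \<open>J\<close> is padded by repeating \<open>b 0\<close>.\<close>
    define s where "s = (\<lambda>i. if i < card J then b i else b 0)"
    have cJ: "0 < card J" using J by (simp add: card_gt_0_iff)
    have sJ: "s i \<in> J" for i using b cJ by (auto simp: s_def bij_betw_def)
    define \<Delta> where "\<Delta> = {a :: nat \<Rightarrow> real. (\<forall>i\<le>n. 0 \<le> a i) \<and> sum a {..n} = 1}"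
    \<comment> \<open>By \<open>contra\<close>, every \<open>g a\<close> with
      \<open>a \<in> \<Delta>\<close> is nonnegative at some point of \<open>P\<close>. The
      alternative then gives one weight vector on \<open>P\<close> for all \<open>a\<close>; the
      vertices of \<open>\<Delta>\<close> show that its barycenter lies in each
      \<open>C t\<close>.\<close>
    define g where "g = (\<lambda>a z. c - (\<Sum>i\<le>n. a i * h (s i) z))"
    have \<Delta>1: "(\<lambda>j. if j = i then 1 else 0) \<in> \<Delta>" if "i \<le> n" for i using that by (simp add: \<Delta>_def)
    have cvx: "convex (g ` \<Delta>)"
      unfolding convex_def
    proof (intro ballI allI impI)
      fix y y' and u v :: real
      assume "y \<in> g ` \<Delta>" "y' \<in> g ` \<Delta>" and uv: "0 \<le> u" "0 \<le> v" "u + v = 1"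
      then obtain a a' where a: "y = g a" "a \<in> \<Delta>" and a': "y' = g a'" "a' \<in> \<Delta>" by blast
      have "(\<lambda>i. u * a i + v * a' i) \<in> \<Delta>"
        using a(2) a'(2) uv by (auto simp: \<Delta>_def sum.distrib sum_distrib_left[symmetric])
      moreover have "u *\<^sub>R y + v *\<^sub>R y' = g (\<lambda>i. u * a i + v * a' i)"
      proof
        fix z
        have "(u *\<^sub>R y + v *\<^sub>R y') z = (u + v) * c - (u * (\<Sum>i\<le>n. a i * h (s i) z) + v * (\<Sum>i\<le>n. a' i * h (s i) z))"
          unfolding a a' g_def by (simp add: scaleR_fun_def algebra_simps)
        also have "\<dots> = g (\<lambda>i. u * a i + v * a' i) z"
          unfolding uv g_def by (simp add: sum_distrib_left sum.distrib algebra_simps)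
        finally show "(u *\<^sub>R y + v *\<^sub>R y') z = g (\<lambda>i. u * a i + v * a' i) z" .
      qed
      ultimately show "u *\<^sub>R y + v *\<^sub>R y' \<in> g ` \<Delta>" by (simp only: imageI)
    qed
    have ne: "g ` \<Delta> \<noteq> {}" using \<Delta>1[of 0] by blast
    have ex: "\<exists>z\<in>P. 0 \<le> y z" if "y \<in> g ` \<Delta>" for y
    proof (rule ccontr)
      assume neg: "\<not> (\<exists>z\<in>P. 0 \<le> y z)"
      obtain a where a: "y = g a" "a \<in> \<Delta>" using \<open>y \<in> g ` \<Delta>\<close> by blast
      have "\<forall>i\<le>card B. s i \<in> T \<and> 0 \<le> a i" using a(2) sJ J(2) by (auto simp: \<Delta>_def n_def)
      moreover have "sum a {..card B} = 1" using a(2) by (simp add: \<Delta>_def n_def)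
      moreover have "\<forall>z\<in>P. c \<le> (\<Sum>i\<le>card B. a i * h (s i) z)"
        using neg unfolding a(1) g_def n_def by force
      ultimately show False using contra by blast
    qed
    obtain m where m': "\<forall>z\<in>P. 0 \<le> m z" "sum m P = 1" "\<forall>y\<in>g ` \<Delta>. 0 \<le> (\<Sum>z\<in>P. m z * y z)"
      using convex_alternative[OF P(1) cvx ne ex] by blast
    then have m: "\<And>z. z \<in> P \<Longrightarrow> 0 \<le> m z" "sum m P = 1" "\<And>y. y \<in> g ` \<Delta> \<Longrightarrow> 0 \<le> (\<Sum>z\<in>P. m z * y z)"
      by blast+
    have "(\<Sum>z\<in>P. m z *\<^sub>R z) \<in> C t" if "t \<in> J" for t
    proof (rule C_I[OF m(1,2)])
      have "t \<in> b ` {0..<card J}" using b \<open>t \<in> J\<close> by (simp add: bij_betw_def)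
      then obtain i where i: "i < card J" "b i = t" by auto
      then have si: "s i = t" "i \<le> n" using J(4) by (auto simp: s_def n_def)
      have "g (\<lambda>j. if j = i then 1 else 0) z = c - h t z" for z
        using si by (simp add: g_def if_distrib[of "\<lambda>x. x * _"] cong: if_cong)
      then have "0 \<le> (\<Sum>z\<in>P. m z * (c - h t z))" using m(3)[OF imageI[OF \<Delta>1[OF si(2)]]] by simp
      also have "\<dots> = c - (\<Sum>z\<in>P. m z * h t z)"
        using m(2) by (simp add: right_diff_distrib sum_subtractf sum_distrib_right[symmetric])
      finally show "(\<Sum>z\<in>P. m z * h t z) \<le> c" by simp
    qed
    then show ?thesis by blast
  qed
  have C_conv: "convex (C t)" for t
    unfolding convex_def
  proof (intro ballI allI impI)
    fix y y' and u v :: real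
    assume "y \<in> C t" "y' \<in> C t" and uv: "0 \<le> u" "0 \<le> v" "u + v = 1"
    then obtain m m' where m: "y = (\<Sum>z\<in>P. m z *\<^sub>R z)" "\<forall>z\<in>P. 0 \<le> m z" "sum m P = 1" "(\<Sum>z\<in>P. m z * h t z) \<le> c"
      and m': "y' = (\<Sum>z\<in>P. m' z *\<^sub>R z)" "\<forall>z\<in>P. 0 \<le> m' z" "sum m' P = 1" "(\<Sum>z\<in>P. m' z * h t z) \<le> c"
      unfolding C_iff by blast
    have "(\<Sum>z\<in>P. (u * m z + v * m' z) *\<^sub>R z) \<in> C t"
    proof (rule C_I)
      show "0 \<le> u * m z + v * m' z" if "z \<in> P" for z using that uv m m' by simp
      show "(\<Sum>z\<in>P. u * m z + v * m' z) = 1"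
        using m m' uv by (simp add: sum.distrib sum_distrib_left[symmetric])
      have "(\<Sum>z\<in>P. (u * m z + v * m' z) * h t z) = u * (\<Sum>z\<in>P. m z * h t z) + v * (\<Sum>z\<in>P. m' z * h t z)"
        by (simp add: sum.distrib sum_distrib_left algebra_simps)
      also have "\<dots> \<le> c" using convex_bound_le[OF m(4) m'(4) uv] .
      finally show "(\<Sum>z\<in>P. (u * m z + v * m' z) * h t z) \<le> c" .
    qed
    also have "(\<Sum>z\<in>P. (u * m z + v * m' z) *\<^sub>R z) = u *\<^sub>R y + v *\<^sub>R y'"
      unfolding m m' by (simp add: scaleR_add_left sum.distrib scaleR_sum_right)
    finally show "u *\<^sub>R y + v *\<^sub>R y' \<in> C t" .
  qed
  have C_span: "C t \<subseteq> span B" for t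
    using P B by (auto simp: C_def intro!: span_sum span_scale)
  have fin: "(\<Inter>t\<in>J. C t) \<noteq> {}" if J: "finite J" "J \<subseteq> T" "J \<noteq> {}" for J
  proof (rule Helly_indexed[OF B(1) J(1,3) C_conv C_span])
    fix J' assume "J' \<subseteq> J" "J' \<noteq> {}" "card J' \<le> card B + 1"
    then show "(\<Inter>t\<in>J'. C t) \<noteq> {}" using small[of J'] J finite_subset by blast
  qed
  \<comment> \<open>The weights are kept with the point: they lie in the simplex over
    \<open>P\<close>, where limits exist. For one \<open>J\<close> they may depend on
    \<open>t\<close>, while the barycenter \<open>w J\<close> does not.\<close>
  define good where "good = (\<lambda>t w m. w = (\<Sum>z\<in>P. m z *\<^sub>R z) \<and> (\<forall>z\<in>P. 0 \<le> m z) \<and> sum m P = 1 \<and> (\<Sum>z\<in>P. m z * h t z) \<le> c)"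
  define w where "w = (\<lambda>J. SOME w. w \<in> (\<Inter>t\<in>J. C t))"
  define m where "m = (\<lambda>J t. SOME m. good t (w J) m)"
  have good: "good t (w J) (m J t)" if J: "finite J" "J \<subseteq> T" "t \<in> J" for J t
  proof -
    have "J \<noteq> {}" using J(3) by blast
    from fin[OF J(1,2) this] have "w J \<in> (\<Inter>t\<in>J. C t)" unfolding w_def by (rule some_in_eq[THEN iffD2])
    then have "w J \<in> C t" using J(3) by blast
    then have "\<exists>m. good t (w J) m" unfolding C_iff good_def .
    then show ?thesis unfolding m_def by (rule someI_ex)
  qed
  have m: "w J = (\<Sum>z\<in>P. m J t z *\<^sub>R z)" "z \<in> P \<Longrightarrow> 0 \<le> m J t z" "sum (m J t) P = 1" "(\<Sum>z\<in>P. m J t z * h t z) \<le> c"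
    if "finite J" "J \<subseteq> T" "t \<in> J" for J t z using good[OF that] unfolding good_def by blast+
  \<comment> \<open>Every fixed \<open>t \<in> T\<close> eventually belongs to \<open>J\<close>, and
    along an ultrafilter all the bounded weights converge simultaneously.\<close>
  obtain U where U: "U \<le> finite_subsets_at_top T" "ultrafilter U"
    by (rule ultrafilter_exists[OF finite_subsets_at_top_neq_bot])
  have Ub: "U \<noteq> bot" using U(2) by (simp add: ultrafilter_def)
  have "eventually (\<lambda>J. finite J \<and> J \<subseteq> T \<and> t \<in> J) (finite_subsets_at_top T)" if "t \<in> T" for t
    unfolding eventually_finite_subsets_at_top using that by (intro exI[of _ "{t}"]) auto
  then have ev: "eventually (\<lambda>J. finite J \<and> J \<subseteq> T \<and> t \<in> J) U" if "t \<in> T" for t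
    using that U(1) by (auto elim!: filter_leD)
  define l where "l = (\<lambda>t z. SOME l. ((\<lambda>J. m J t z) \<longlongrightarrow> l) U)"
  have l: "((\<lambda>J. m J t z) \<longlongrightarrow> l t z) U" if tz: "t \<in> T" "z \<in> P" for t z
  proof -
    have "eventually (\<lambda>J. m J t z \<in> {0..1}) U"
      using ev[OF tz(1)]
    proof eventually_elim
      case (elim J)
      then have "m J t z \<le> sum (m J t) P" using m(2)[of J t] tz(2) P(1) by (intro member_le_sum) auto
      then show ?case using m(2,3)[of J t] elim tz(2) by simp
    qed
    then have "\<exists>l. ((\<lambda>J. m J t z) \<longlongrightarrow> l) U"
      using ultrafilter_converges[OF U(2) compact_Icc, of "\<lambda>J. m J t z"] by blast
    then show ?thesis unfolding l_def by (rule someI_ex)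
  qed
  have l0: "0 \<le> l t z" if tz: "t \<in> T" "z \<in> P" for t z
  proof (rule tendsto_lowerbound[OF l[OF tz] _ Ub])
    show "\<forall>\<^sub>F J in U. 0 \<le> m J t z" using ev[OF tz(1)] by eventually_elim (use m(2) tz(2) in blast)
  qed
  have l1: "sum (l t) P = 1" if t: "t \<in> T" for t
  proof (rule tendsto_unique[OF Ub])
    show "((\<lambda>J. sum (m J t) P) \<longlongrightarrow> sum (l t) P) U" using l[OF t] by (intro tendsto_sum) auto
    show "((\<lambda>J. sum (m J t) P) \<longlongrightarrow> 1) U"
      using ev[OF t] by (intro tendsto_eventually) (auto elim!: eventually_mono simp: m)
  qed
  have lc: "(\<Sum>z\<in>P. l t z * h t z) \<le> c" if t: "t \<in> T" for t
  proof (rule tendsto_upperbound[OF _ _ Ub])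
    show "((\<lambda>J. \<Sum>z\<in>P. m J t z * h t z) \<longlongrightarrow> (\<Sum>z\<in>P. l t z * h t z)) U"
      using l[OF t] by (intro tendsto_sum tendsto_mult) auto
    show "\<forall>\<^sub>F J in U. (\<Sum>z\<in>P. m J t z * h t z) \<le> c"
      using ev[OF t] by (auto elim!: eventually_mono simp: m)
  qed
  define y where "y = (\<Sum>z\<in>P. l t0 z *\<^sub>R z)"
  \<comment> \<open>The barycenters for \<open>t\<close> and \<open>t0\<close> agree as soon as
    \<open>J\<close> contains both, and a linear functional carries this equality to the limit
    weights.\<close>
  have y: "y = (\<Sum>z\<in>P. l t z *\<^sub>R z)" if t: "t \<in> T" for t
  proof (rule linear_functionals_separate)
    fix k :: "'b \<Rightarrow> real" assume k: "linear k"
    have lim: "((\<lambda>J. \<Sum>z\<in>P. m J t z * k z) \<longlongrightarrow> (\<Sum>z\<in>P. l t z * k z)) U" if "t \<in> T" for t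
      using l[OF that] by (intro tendsto_sum tendsto_mult) auto
    have "eventually (\<lambda>J. (\<Sum>z\<in>P. m J t z * k z) = (\<Sum>z\<in>P. m J t0 z * k z)) U"
      using ev[OF t] ev[OF t0]
    proof eventually_elim
      case (elim J)
      then have "k (\<Sum>z\<in>P. m J t z *\<^sub>R z) = k (\<Sum>z\<in>P. m J t0 z *\<^sub>R z)"
        using m(1)[of J t] m(1)[of J t0] by simp
      then show ?case by (simp add: linear_sum[OF k] linear_scale[OF k])
    qed
    then have "((\<lambda>J. \<Sum>z\<in>P. m J t z * k z) \<longlongrightarrow> (\<Sum>z\<in>P. l t0 z * k z)) U"
      using lim[OF t0] by (simp add: tendsto_cong)
    with lim[OF t] have "(\<Sum>z\<in>P. l t z * k z) = (\<Sum>z\<in>P. l t0 z * k z)"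
      by (rule tendsto_unique[OF Ub])
    then show "k y = k (\<Sum>z\<in>P. l t z *\<^sub>R z)"
      by (simp add: y_def linear_sum[OF k] linear_scale[OF k])
  qed
  have "y \<in> D" unfolding y_def by (rule convex_sum[OF P(1) convD l1[OF t0] l0[OF t0]]) (use P(2) in auto)
  then obtain t where t: "t \<in> T" "c < h t y" using gt by blast
  have "h t y \<le> (\<Sum>z\<in>P. l t z * h t z)"
    unfolding y[OF t(1)] by (rule convex_on_sum[OF P(1,3) h[OF t(1)] l1[OF t(1)] l0[OF t(1)]]) (use P(2) in auto)
  then show False using lc[OF t(1)] t(2) by simp
qed

section \<open>Continuous functionals on locally convex spaces\<close>

lemma tendsto_scaleR_tvs:
  fixes g :: "'i \<Rightarrow> 'a::topological_real_vector"
  assumes "(f \<longlongrightarrow> a) F" "(g \<longlongrightarrow> b) F"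
  shows "((\<lambda>x. f x *\<^sub>R g x) \<longlongrightarrow> a *\<^sub>R b) F"
  using filterlim_compose[OF tendsto_scaleR_nhds filterlim_Pair[OF assms]] by simp

lemma dual_spaceD:
  assumes "\<phi> \<in> dual_space"
  shows "linear \<phi>" "continuous_on UNIV \<phi>"
  using assms by (simp_all add: dual_space_def)

lemma dual_space_add_scale:
  assumes "\<phi> \<in> dual_space" "\<psi> \<in> dual_space"
  shows "(\<lambda>y. \<phi> y + r * \<psi> y) \<in> dual_space"
proof -
  note l = dual_spaceD[OF assms(1)] dual_spaceD[OF assms(2)]
  have "linear (\<lambda>y. \<phi> y + r * \<psi> y)"
    by (rule linearI) (simp_all add: linear_add[OF l(1)] linear_add[OF l(3)] linear_scale[OF l(1)] linear_scale[OF l(3)] algebra_simps)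
  then show ?thesis unfolding dual_space_def using l by (auto intro!: continuous_intros)
qed

lemma dual_space_sum:
  assumes "\<And>i. i \<in> I \<Longrightarrow> \<Phi> i \<in> dual_space"
  shows "(\<lambda>y. \<Sum>i\<in>I. r i * \<Phi> i y) \<in> dual_space"
  using assms
proof (induction I rule: infinite_finite_induct)
  case (insert i I)
  then show ?case using dual_space_add_scale[of "\<lambda>y. \<Sum>i\<in>I. r i * \<Phi> i y" "\<Phi> i" "r i"] by (simp add: add.commute)
qed (auto simp: dual_space_def linear_zero)

text \<open>A one-sided bound suffices, because both \<open>y - x\<close> and \<open>x - y\<close>
  can be scaled into \<open>V\<close>. The factor \<open>2 / e\<close> gives the bound
  \<open>e / 2\<close>, strictly below \<open>e\<close>.\<close>

lemma bounded_above_imp_dual: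
  fixes l :: "'a::separated_lcs \<Rightarrow> real"
  assumes l: "linear l" and V: "open V" "0 \<in> V" and le: "\<And>u. u \<in> V \<Longrightarrow> l u \<le> 1"
  shows "l \<in> dual_space"
proof -
  have "(l \<longlongrightarrow> l x) (at x)" for x
  proof (rule tendstoI)
    fix e :: real assume e: "e > 0"
    have "((\<lambda>y. (2 / e) *\<^sub>R (y - x)) \<longlongrightarrow> (2 / e) *\<^sub>R (x - x)) (at x)"
      by (intro tendsto_scaleR_tvs tendsto_const tendsto_diff tendsto_ident_at)
    then have 1: "eventually (\<lambda>y. (2 / e) *\<^sub>R (y - x) \<in> V) (at x)"
      by (rule topological_tendstoD[OF _ V(1)]) (simp add: V(2))
    have "((\<lambda>y. (2 / e) *\<^sub>R (x - y)) \<longlongrightarrow> (2 / e) *\<^sub>R (x - x)) (at x)"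
      by (intro tendsto_scaleR_tvs tendsto_const tendsto_diff tendsto_ident_at)
    then have 2: "eventually (\<lambda>y. (2 / e) *\<^sub>R (x - y) \<in> V) (at x)"
      by (rule topological_tendstoD[OF _ V(1)]) (simp add: V(2))
    show "eventually (\<lambda>y. dist (l y) (l x) < e) (at x)"
      using 1 2
    proof eventually_elim
      case (elim y)
      have "(2 / e) * (l y - l x) \<le> 1" "(2 / e) * (l x - l y) \<le> 1"
        using le[OF elim(1)] le[OF elim(2)] by (simp_all add: linear_scale[OF l] linear_diff[OF l])
      then have "l y - l x \<le> e / 2" "l x - l y \<le> e / 2" using e by (simp_all add: field_simps)
      then show ?case using e by (simp add: dist_real_def abs_real_def)
    qed
  qed
  then show ?thesis
    using l by (simp add: dual_space_def continuous_on_eq_continuous_at isCont_def)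
qed

text \<open>A convex neighbourhood \<open>V\<close> of 0 missing \<open>v\<close> is separated from
  \<open>v\<close> by a functional that is 1 at \<open>v\<close> and at most 1 on \<open>V\<close>;
  the second property makes it continuous.\<close>

lemma dual_space_separates:
  fixes v :: "'a::separated_lcs"
  assumes "v \<noteq> 0"
  shows "\<exists>\<phi>\<in>dual_space. \<phi> v \<noteq> 0"
proof -
  obtain U where U: "open U" "0 \<in> U" "v \<notin> U" using assms separation_t1[of 0 v] by metis
  obtain V where V: "open V" "0 \<in> V" "V \<subseteq> U" "convex V" using locally_convex[OF U(1,2)] by blast
  \<comment> \<open>For this set the conclusion of Hahn--Banach reads
    \<open>l u - a * l v \<le> 1 - a\<close> for all real \<open>a\<close>, which forces
    \<open>l v = 1\<close>.\<close>
  define K where "K = {(u - a *\<^sub>R v, 1 - a) | u a. u \<in> V}"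
  have K_I: "(u - a *\<^sub>R v, 1 - a) \<in> K" if "u \<in> V" for u a
    unfolding K_def using that by blast
  have "convex K"
    unfolding convex_def
  proof (intro ballI allI impI)
    fix p q and s t :: real
    assume "p \<in> K" "q \<in> K" and st: "0 \<le> s" "0 \<le> t" "s + t = 1"
    then obtain u a u' a' where p: "p = (u - a *\<^sub>R v, 1 - a)" "u \<in> V" and q: "q = (u' - a' *\<^sub>R v, 1 - a')" "u' \<in> V"
      by (auto simp: K_def)
    have "((s *\<^sub>R u + t *\<^sub>R u') - (s * a + t * a') *\<^sub>R v, 1 - (s * a + t * a')) \<in> K"
      using convexD[OF V(4) p(2) q(2) st] by (rule K_I)
    also have "((s *\<^sub>R u + t *\<^sub>R u') - (s * a + t * a') *\<^sub>R v, 1 - (s * a + t * a')) = s *\<^sub>R p + t *\<^sub>R q"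
      unfolding p(1) q(1) using st(3) by (simp add: algebra_simps)
    finally show "s *\<^sub>R p + t *\<^sub>R q \<in> K" .
  qed
  moreover have "0 \<le> r" if "(0, r) \<in> K" for r
  proof (rule ccontr)
    assume r: "\<not> 0 \<le> r"
    obtain u a where ua: "u \<in> V" "u = a *\<^sub>R v" "r = 1 - a" using \<open>(0, r) \<in> K\<close> by (auto simp: K_def)
    have a: "a > 1" using r ua(3) by simp
    have "(1 / a) *\<^sub>R u + (1 - 1 / a) *\<^sub>R 0 \<in> V" using a by (intro convexD[OF V(4) ua(1) V(2)]) auto
    then have "v \<in> V" using a ua(2) by simp
    then show False using U(3) V(3) by blast
  qed
  moreover have "\<exists>s>0. \<exists>r. (s *\<^sub>R w, r) \<in> K" for w
  proof -
    have "((\<lambda>s. s *\<^sub>R w) \<longlongrightarrow> 0 *\<^sub>R w) (at_right 0)"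
      by (intro tendsto_scaleR_tvs tendsto_const tendsto_ident_at)
    then have "eventually (\<lambda>s. s *\<^sub>R w \<in> V) (at_right 0)"
      by (rule topological_tendstoD[OF _ V(1)]) (simp add: V(2))
    moreover have "eventually (\<lambda>s::real. s > 0) (at_right 0)" by (simp add: eventually_at_right_less)
    ultimately have "eventually (\<lambda>s. s > 0 \<and> s *\<^sub>R w \<in> V) (at_right 0)" by eventually_elim simp
    then obtain s where s: "s > 0" "s *\<^sub>R w \<in> V"
      using eventually_happens'[OF trivial_limit_at_right_real] by blast
    from K_I[OF s(2), of 0] have "(s *\<^sub>R w, 1) \<in> K" by simp
    with s(1) show ?thesis by blast
  qed
  ultimately obtain l where l: "linear l" "\<And>w r. (w, r) \<in> K \<Longrightarrow> l w \<le> r"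
    using Hahn_Banach_convex_set[of K] by blast
  have le: "l u - a * l v \<le> 1 - a" if "u \<in> V" for u a
    using l(2)[OF K_I[OF that]] by (simp add: linear_diff[OF l(1)] linear_scale[OF l(1)])
  have lv: "l v = 1"
  proof (rule ccontr)
    assume ne: "l v \<noteq> 1"
    define d where "d = 1 - l v"
    have "a * d \<le> 1" for a using le[OF V(2), of a] by (simp add: linear_0[OF l(1)] d_def algebra_simps)
    from this[of "2 / d"] show False using ne by (simp add: d_def[symmetric]) (simp add: d_def)
  qed
  have "l \<in> dual_space" by (rule bounded_above_imp_dual[OF l(1) V(1,2)]) (use le[of _ 0] in simp)
  with lv show ?thesis by (intro bexI[of _ l]) simp_all
qed

text \<open>A Gram--Schmidt induction: removing from \<open>b\<close> its coordinates along
  \<open>B\<close> leaves \<open>v \<noteq> 0\<close>. A functional nonzero at \<open>v\<close> is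
  corrected to vanish on \<open>B\<close> and normalized at \<open>b\<close>; the old functionals
  are then corrected to vanish at \<open>b\<close>.\<close>

lemma biorthogonal_system:
  fixes B :: "'a::separated_lcs set"
  assumes "finite B" "independent B"
  shows "\<exists>\<Phi>. (\<forall>b\<in>B. \<Phi> b \<in> dual_space) \<and> (\<forall>b\<in>B. \<forall>d\<in>B. \<Phi> b d = (if d = b then 1 else 0))"
  using assms
proof (induction B rule: finite_induct)
  case empty
  then show ?case by simp
next
  case (insert b B)
  have ind: "independent B" "b \<notin> span B" using insert.prems insert.hyps by (auto simp: independent_insert)
  obtain \<Phi> where \<Phi>: "\<And>c. c \<in> B \<Longrightarrow> \<Phi> c \<in> dual_space"
      "\<And>c d. c \<in> B \<Longrightarrow> d \<in> B \<Longrightarrow> \<Phi> c d = (if d = c then 1 else 0)"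
    using insert.IH[OF ind(1)] by blast
  define v where "v = b - (\<Sum>c\<in>B. \<Phi> c b *\<^sub>R c)"
  have "(\<Sum>c\<in>B. \<Phi> c b *\<^sub>R c) \<in> span B" by (intro span_sum span_scale span_base)
  then have "v \<noteq> 0" using ind(2) by (auto simp: v_def)
  then obtain \<phi> where \<phi>: "\<phi> \<in> dual_space" "\<phi> v \<noteq> 0" using dual_space_separates by blast
  note lin = dual_spaceD(1)[OF \<phi>(1)]
  define k where "k = (\<lambda>y. \<phi> y - (\<Sum>c\<in>B. \<phi> c * \<Phi> c y))"
  have k_dual: "k \<in> dual_space"
  proof -
    have "(\<lambda>y. \<Sum>c\<in>B. \<phi> c * \<Phi> c y) \<in> dual_space" by (intro dual_space_sum \<Phi>(1))
    from dual_space_add_scale[OF \<phi>(1) this, of "-1"] show ?thesis by (simp add: k_def)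
  qed
  have kb: "k b = \<phi> v" by (simp add: k_def v_def linear_diff[OF lin] linear_sum[OF lin] linear_scale[OF lin] mult.commute)
  have kB: "k d = 0" if d: "d \<in> B" for d
  proof -
    have "(\<Sum>c\<in>B. \<phi> c * \<Phi> c d) = (\<Sum>c\<in>B. if c = d then \<phi> d else 0)"
      using d by (intro sum.cong) (auto simp: \<Phi>(2))
    then show ?thesis using d insert.hyps(1) by (simp add: k_def)
  qed
  define k1 where "k1 = (\<lambda>y. 0 + (1 / \<phi> v) * k y)"
  have "(\<lambda>_. 0) \<in> (dual_space :: ('a \<Rightarrow> real) set)" by (simp add: dual_space_def linear_zero)
  then have k1_dual: "k1 \<in> dual_space" unfolding k1_def by (rule dual_space_add_scale[OF _ k_dual])
  have k1: "k1 b = 1" "\<And>d. d \<in> B \<Longrightarrow> k1 d = 0" using \<phi>(2) by (simp_all add: k1_def kb kB)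
  define \<Psi> where "\<Psi> = (\<lambda>c. if c = b then k1 else (\<lambda>y. \<Phi> c y + (- \<Phi> c b) * k1 y))"
  have "\<forall>c\<in>insert b B. \<Psi> c \<in> dual_space"
    
  proof
    fix c assume "c \<in> insert b B"
    then show "\<Psi> c \<in> dual_space"
      unfolding \<Psi>_def using k1_dual dual_space_add_scale[OF \<Phi>(1) k1_dual, of c "- \<Phi> c b"] by (cases "c = b") auto
  qed
  moreover have "\<forall>c\<in>insert b B. \<forall>d\<in>insert b B. \<Psi> c d = (if d = c then 1 else 0)"
    using insert.hyps(2) k1 \<Phi>(2) by (auto simp: \<Psi>_def)
  ultimately show ?case by blast
qed

text \<open>Functionals obtained algebraically have no continuity. On a finite-dimensional subspace
  they agree with a combination of continuous functionals biorthogonal to a basis.\<close>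

lemma dual_space_extension:
  fixes l :: "'a::separated_lcs \<Rightarrow> real"
  assumes l: "linear l" and B: "finite B"
  shows "\<exists>\<phi>\<in>dual_space. \<forall>y\<in>span B. \<phi> y = l y"
proof -
  obtain A where A: "A \<subseteq> B" "independent A" "B \<subseteq> span A" using maximal_independent_subset[of B] by blast
  have fin: "finite A" using A(1) B by (rule finite_subset)
  obtain \<Phi> where \<Phi>: "\<And>c. c \<in> A \<Longrightarrow> \<Phi> c \<in> dual_space"
      "\<And>c d. c \<in> A \<Longrightarrow> d \<in> A \<Longrightarrow> \<Phi> c d = (if d = c then 1 else 0)"
    using biorthogonal_system[OF fin A(2)] by blast
  define \<phi> where "\<phi> = (\<lambda>y. \<Sum>c\<in>A. l c * \<Phi> c y)"
  have \<phi>: "\<phi> \<in> dual_space" unfolding \<phi>_def by (intro dual_space_sum \<Phi>(1))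
  have on_A: "\<phi> d = l d" if d: "d \<in> A" for d
  proof -
    have "\<phi> d = (\<Sum>c\<in>A. if c = d then l d else 0)" unfolding \<phi>_def using d by (intro sum.cong) (auto simp: \<Phi>(2))
    then show ?thesis using d fin by simp
  qed
  have "span B \<subseteq> span A" using A(3) by (intro span_minimal subspace_span)
  then have "\<phi> y = l y" if "y \<in> span B" for y
    using linear_eq_on_span[OF dual_spaceD(1)[OF \<phi>] l on_A] that by blast
  with \<phi> show ?thesis by blast
qed

section \<open>The sum rule for convex functions with a common domain\<close>

text \<open>\<open>D\<close> contains the simplex with vertices \<open>x\<close> and
  \<open>x + b\<close>, where the vectors \<open>b\<close> are a basis of the span of
  \<open>D - x\<close> taken from \<open>D - x\<close>. Its barycenter can be moved a little in
  every direction of that span.\<close>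

lemma convex_relative_core:
  fixes D :: "'b::real_vector set"
  assumes D: "convex D" "x \<in> D" and B: "finite B" "D \<subseteq> span B"
  shows "\<exists>z\<in>D. \<forall>w\<in>span ((\<lambda>z. z - x) ` D). \<exists>s>0. \<forall>s'. 0 \<le> s' \<and> s' \<le> s \<longrightarrow> z + s' *\<^sub>R w \<in> D"
proof -
  let ?E = "(\<lambda>z. z - x) ` D"
  obtain A where A: "A \<subseteq> ?E" "independent A" "?E \<subseteq> span A" using maximal_independent_subset[of ?E] by blast
  have "?E \<subseteq> span B" using D B by (auto intro!: span_diff)
  then have fin: "finite A" using independent_span_bound[OF B(1) A(2)] A(1) by blast
  have A0: "0 \<notin> A" using A(2) dependent_zero by blast
  have AD: "x + b \<in> D" if "b \<in> A" for b using A(1) that by auto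
  have sub: "x + (\<Sum>b\<in>A. k b *\<^sub>R b) \<in> D" if k: "\<And>b. b \<in> A \<Longrightarrow> 0 \<le> k b" "sum k A \<le> 1" for k
  proof -
    \<comment> \<open>As \<open>0 \<notin> A\<close>, the index 0 is free to stand for the vertex
      \<open>x\<close> and takes the remaining weight.\<close>
    define k' where "k' = k(0 := 1 - sum k A)"
    have eq: "k' b = k b" if "b \<in> A" for b using that A0 by (auto simp: k'_def)
    have s: "sum k' A = sum k A" using eq by (intro sum.cong) auto
    have "(\<Sum>b\<in>insert 0 A. k' b *\<^sub>R (x + b)) \<in> D"
    proof (rule convex_sum[OF _ D(1)])
      show "sum k' (insert 0 A) = 1" using fin A0 s by (simp add: k'_def)
      show "0 \<le> k' i" if "i \<in> insert 0 A" for i using that k eq[of i] by (auto simp: k'_def)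
      show "x + i \<in> D" if "i \<in> insert 0 A" for i using that AD D(2) by auto
    qed (use fin in simp)
    also have "(\<Sum>b\<in>insert 0 A. k' b *\<^sub>R (x + b)) = (k' 0 + sum k' A) *\<^sub>R x + (\<Sum>b\<in>A. k' b *\<^sub>R b)"
      using fin A0 by (simp add: scaleR_add_right sum.distrib scaleR_add_left scaleR_sum_left)
    also have "\<dots> = x + (\<Sum>b\<in>A. k b *\<^sub>R b)"
      using eq by (simp add: s) (simp add: k'_def)
    finally show ?thesis .
  qed
  \<comment> \<open>The number of vertices: every vertex, \<open>x\<close> included, has weight
    \<open>1 / m\<close> in the barycenter \<open>z\<close>.\<close>
  define m where "m = real (card A) + 1"
  have m: "m > 0" by (simp add: m_def)
  define z where "z = x + (\<Sum>b\<in>A. (1 / m) *\<^sub>R b)"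
  have "z \<in> D" unfolding z_def by (rule sub) (use m in \<open>auto simp: m_def\<close>)
  moreover have "\<exists>s>0. \<forall>s'. 0 \<le> s' \<and> s' \<le> s \<longrightarrow> z + s' *\<^sub>R w \<in> D" if w: "w \<in> span ?E" for w
  proof -
    have "span ?E \<subseteq> span A" using A(3) by (intro span_minimal subspace_span)
    then obtain r where r: "w = (\<Sum>b\<in>A. r b *\<^sub>R b)" using w span_finite[OF fin] by auto
    define R where "R = (\<Sum>b\<in>A. \<bar>r b\<bar>)"
    have R0: "R \<ge> 0" unfolding R_def by (intro sum_nonneg) auto
    \<comment> \<open>A step of length at most \<open>s\<close> changes each coordinate by at most
      \<open>1 / m\<close> and raises the sum of the coordinates by at most \<open>1 / m\<close>,
      the weight of \<open>x\<close>. The summand 1 avoids division by zero.\<close>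
    define s where "s = 1 / (m * (1 + R))"
    have s: "s > 0" using m R0 by (simp add: s_def)
    have "z + s' *\<^sub>R w \<in> D" if s': "0 \<le> s'" "s' \<le> s" for s'
    proof -
      have "s * (1 + R) = 1 / m" using m R0 by (simp add: s_def)
      then have sR: "s' * R \<le> 1 / m"
        using mult_mono[OF s'(2), of R "1 + R"] R0 s by simp
      have "z + s' *\<^sub>R w = x + (\<Sum>b\<in>A. (1 / m + s' * r b) *\<^sub>R b)"
        unfolding z_def r by (simp add: scaleR_sum_right sum.distrib scaleR_add_left)
      also have "\<dots> \<in> D"
      proof (rule sub)
        fix b assume b: "b \<in> A"
        have "\<bar>r b\<bar> \<le> R" unfolding R_def using b fin by (intro member_le_sum) auto
        then have "s' * \<bar>r b\<bar> \<le> 1 / m" using mult_left_mono[OF _ s'(1)] sR by fastforce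
        moreover have "s' * r b \<ge> - (s' * \<bar>r b\<bar>)"
          using mult_left_mono[OF _ s'(1), of "- \<bar>r b\<bar>" "r b"] by simp
        ultimately show "0 \<le> 1 / m + s' * r b" by linarith
      next
        have "(\<Sum>b\<in>A. r b) \<le> R" unfolding R_def by (intro sum_mono) simp
        then have "s' * (\<Sum>b\<in>A. r b) \<le> 1 / m" using mult_left_mono[OF _ s'(1)] sR by fastforce
        moreover have "(\<Sum>b\<in>A. 1 / m + s' * r b) = (m - 1) / m + s' * (\<Sum>b\<in>A. r b)"
          by (simp add: sum.distrib sum_distrib_left m_def)
        ultimately have "(\<Sum>b\<in>A. 1 / m + s' * r b) \<le> (m - 1) / m + 1 / m" by linarith
        also have "\<dots> = 1" using m by (simp add: field_simps)
        finally show "(\<Sum>b\<in>A. 1 / m + s' * r b) \<le> 1" .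
      qed
      finally show ?thesis .
    qed
    with s show ?thesis by blast
  qed
  ultimately show ?thesis by blast
qed

text \<open>\<open>G i\<close> plays the role of the (strict) epigraph of a convex function with domain \<open>D\<close>. The
  Hahn--Banach theorem is applied to the perturbation
  \<open>w \<mapsto> inf {\<Sum>i\<in>I. a i * (y i - c - \<phi> (u i - x)) | (u i, y i) \<in> G i, u i = z + w i}\<close>,
  which is finite near \<open>0\<close> because \<open>D\<close> has a relative core.\<close>

theorem convex_sum_rule:
  fixes G :: "'i \<Rightarrow> ('b::real_vector \<times> real) set" and \<phi> :: "'b \<Rightarrow> real"
  assumes B: "finite B" "D \<subseteq> span B" and D: "convex D" "x \<in> D"
    and I: "finite I" "\<And>i. i \<in> I \<Longrightarrow> 0 < a i" "sum a I = 1"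
    and G: "\<And>i. i \<in> I \<Longrightarrow> convex (G i)" "\<And>i z y. i \<in> I \<Longrightarrow> (z, y) \<in> G i \<Longrightarrow> z \<in> D"
      "\<And>i z. i \<in> I \<Longrightarrow> z \<in> D \<Longrightarrow> \<exists>y. (z, y) \<in> G i"
      "\<And>i e. i \<in> I \<Longrightarrow> 0 < e \<Longrightarrow> (x, c + e) \<in> G i"
    and \<phi>: "linear \<phi>"
    and main: "\<And>z y. (\<And>i. i \<in> I \<Longrightarrow> (z, y i) \<in> G i) \<Longrightarrow> c + \<phi> (z - x) \<le> (\<Sum>i\<in>I. a i * y i)"
  shows "\<exists>l. (\<forall>i\<in>I. linear (l i) \<and> (\<forall>z y. (z, y) \<in> G i \<longrightarrow> c + l i (z - x) \<le> y)) \<and>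
    (\<forall>w\<in>span ((\<lambda>z. z - x) ` D). (\<Sum>i\<in>I. a i * l i w) = \<phi> w)"
proof -
  let ?W = "span ((\<lambda>z. z - x) ` D)"
  have WD: "z - x \<in> ?W" if "z \<in> D" for z using that by (intro span_base imageI)
  obtain i0 where i0: "i0 \<in> I" using I(3) by force
  \<comment> \<open>\<open>K\<close> has to absorb the whole function space, but only displacements
    in \<open>?W\<close> can stay in \<open>D\<close>. Projecting the perturbations to
    \<open>?W\<close> reconciles the two.\<close>
  obtain p where p: "range p \<subseteq> ?W" "linear p" "\<And>v. v \<in> ?W \<Longrightarrow> p v = v"
    using linear_exists_left_inverse_on[OF linear_ident subspace_span, of "(\<lambda>z. z - x) ` D"] by auto
  define r where "r = (\<lambda>u y. \<Sum>i\<in>I. a i * (y i - c - \<phi> (u i - x)))"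
  define K where "K = {(w, r u y) | w u y. \<exists>z. \<forall>i\<in>I. (u i, y i) \<in> G i \<and> p (w i) = u i - z}"
  have K_I: "(w, r u y) \<in> K" if "\<And>i. i \<in> I \<Longrightarrow> (u i, y i) \<in> G i" "\<And>i. i \<in> I \<Longrightarrow> p (w i) = u i - z" for w u y z
    unfolding K_def using that by blast
  have K_E: "\<exists>u y z. s = r u y \<and> (\<forall>i\<in>I. (u i, y i) \<in> G i \<and> p (w i) = u i - z)" if "(w, s) \<in> K" for w s
    using that unfolding K_def by blast
  have "convex K"
    unfolding convex_def
  proof (intro ballI allI impI)
    fix q q' and s t :: real
    assume q: "q \<in> K" "q' \<in> K" and st: "0 \<le> s" "0 \<le> t" "s + t = 1"
    obtain w R w' R' where qq: "q = (w, R)" "q' = (w', R')" by (meson surj_pair)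
    obtain u y z where u: "R = r u y" "\<And>i. i \<in> I \<Longrightarrow> (u i, y i) \<in> G i" "\<And>i. i \<in> I \<Longrightarrow> p (w i) = u i - z"
      using K_E[of w R] q qq by blast
    obtain u' y' z' where u': "R' = r u' y'" "\<And>i. i \<in> I \<Longrightarrow> (u' i, y' i) \<in> G i" "\<And>i. i \<in> I \<Longrightarrow> p (w' i) = u' i - z'"
      using K_E[of w' R'] q qq by blast
    define v where "v = (\<lambda>i. s *\<^sub>R u i + t *\<^sub>R u' i)"
    define k where "k = (\<lambda>i. s * y i + t * y' i)"
    have "(s *\<^sub>R w + t *\<^sub>R w', r v k) \<in> K"
    proof (rule K_I)
      fix i assume i: "i \<in> I"
      show "(v i, k i) \<in> G i" using convexD[OF G(1)[OF i] u(2)[OF i] u'(2)[OF i] st] by (simp add: v_def k_def)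
      show "p ((s *\<^sub>R w + t *\<^sub>R w') i) = v i - (s *\<^sub>R z + t *\<^sub>R z')"
        by (simp add: scaleR_fun_def linear_add[OF p(2)] linear_scale[OF p(2)] u(3)[OF i] u'(3)[OF i] v_def algebra_simps)
    qed
    moreover have "r v k = s * R + t * R'"
    proof -
      have "k i - c - \<phi> (v i - x) = s * (y i - c - \<phi> (u i - x)) + t * (y' i - c - \<phi> (u' i - x))" for i
      proof -
        have "k i - c - \<phi> (v i - x) = k i - (s + t) * c - \<phi> (v i - (s + t) *\<^sub>R x)" using st by simp
        then show ?thesis
          by (simp add: k_def v_def linear_add[OF \<phi>] linear_diff[OF \<phi>] linear_scale[OF \<phi>] algebra_simps)
      qed
      then show ?thesis
        unfolding u(1) u'(1) r_def by (simp only: distrib_left sum.distrib sum_distrib_left mult.left_commute)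
    qed
    ultimately show "s *\<^sub>R q + t *\<^sub>R q' \<in> K" by (simp add: qq)
  qed
  moreover have "0 \<le> R" if "(0, R) \<in> K" for R
  proof -
    obtain u y z where u: "R = r u y" "\<And>i. i \<in> I \<Longrightarrow> (u i, y i) \<in> G i" "\<And>i. i \<in> I \<Longrightarrow> p 0 = u i - z"
      using K_E[OF \<open>(0, R) \<in> K\<close>] by auto
    have uz: "u i = z" if "i \<in> I" for i using u(3)[OF that] by (simp add: linear_0[OF p(2)])
    have "c + \<phi> (z - x) \<le> (\<Sum>i\<in>I. a i * y i)" using u(2) uz by (intro main) auto
    also have "\<dots> = R + sum a I * (c + \<phi> (z - x))"
      unfolding u(1) r_def sum_distrib_right sum.distrib[symmetric] using uz by (intro sum.cong) (auto simp: algebra_simps)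
    finally show ?thesis by (simp add: I(3))
  qed
  moreover have "\<exists>s>0. \<exists>R. (s *\<^sub>R w, R) \<in> K" for w
  proof -
    obtain z where z: "z \<in> D" "\<And>w. w \<in> ?W \<Longrightarrow> \<exists>s>0. \<forall>s'. 0 \<le> s' \<and> s' \<le> s \<longrightarrow> z + s' *\<^sub>R w \<in> D"
      using convex_relative_core[OF D B] by blast
    have "\<forall>i. \<exists>s>0. \<forall>s'. 0 \<le> s' \<and> s' \<le> s \<longrightarrow> z + s' *\<^sub>R p (w i) \<in> D"
      using p(1) by (intro allI z(2)) auto
    then obtain S where S: "\<And>i. S i > 0" "\<And>i s'. 0 \<le> s' \<Longrightarrow> s' \<le> S i \<Longrightarrow> z + s' *\<^sub>R p (w i) \<in> D"
      using choice[of "\<lambda>i s. s > 0 \<and> (\<forall>s'. 0 \<le> s' \<and> s' \<le> s \<longrightarrow> z + s' *\<^sub>R p (w i) \<in> D)"] by blast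
    define s where "s = Min (S ` I)"
    have "s \<in> S ` I" unfolding s_def using I(1) i0 by (intro Min_in) auto
    then have s: "s > 0" "\<And>i. i \<in> I \<Longrightarrow> s \<le> S i"
      using I(1) S(1) by (auto simp: s_def)
    define u where "u = (\<lambda>i. z + s *\<^sub>R p (w i))"
    have "\<exists>y. (u i, y) \<in> G i" if "i \<in> I" for i
      using S(2)[of s i] s that unfolding u_def by (intro G(3)) auto
    then obtain y where "\<And>i. i \<in> I \<Longrightarrow> (u i, y i) \<in> G i"
      using bchoice[of I "\<lambda>i y. (u i, y) \<in> G i"] by blast
    then have "(s *\<^sub>R w, r u y) \<in> K"
      by (rule K_I[where z = z]) (simp_all add: u_def scaleR_fun_def linear_scale[OF p(2)])
    with s(1) show ?thesis by blast
  qed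
  ultimately obtain L where L: "linear L" "\<And>w R. (w, R) \<in> K \<Longrightarrow> L w \<le> R"
    using Hahn_Banach_convex_set[of K] by blast
  define e where "e = (\<lambda>(i::'i) (v::'b) j. if j = i then v else 0)"
  have e_lin: "e i (v + v') = e i v + e i v'" "e i (s *\<^sub>R v) = s *\<^sub>R e i v" for i v v' s
    by (auto simp: e_def scaleR_fun_def)
  \<comment> \<open>Each coordinate of \<open>L\<close>, divided by its weight, corrects
    \<open>\<phi>\<close>; in the weighted sum the corrections cancel on \<open>?W\<close>.\<close>
  define l where "l = (\<lambda>i v. \<phi> v + L (e i v) / a i)"
  have "linear (l i)" for i
    by (rule linearI)
      (simp_all add: l_def e_lin linear_add[OF L(1)] linear_scale[OF L(1)] linear_add[OF \<phi>] linear_scale[OF \<phi>] add_divide_distrib distrib_left)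
  moreover have "c + l i (z - x) \<le> y" if i: "i \<in> I" and zy: "(z, y) \<in> G i" for i z y
  proof -
    have zD: "z \<in> D" using G(2) i zy by blast
    \<comment> \<open>Only coordinate \<open>i\<close> is perturbed; the others stay at
      \<open>x\<close>. Their height is \<open>c + d\<close>, since \<open>(x, c)\<close> itself
      need not lie in \<open>G j\<close>, and \<open>d\<close> is arbitrarily small.\<close>
    have "L (e i (z - x)) \<le> a i * (y - c - \<phi> (z - x))"
    proof (rule field_le_epsilon)
      fix d :: real assume d: "d > 0"
      define u where "u = (\<lambda>j. if j = i then z else x)"
      define k where "k = (\<lambda>j. if j = i then y else c + d)"
      have "(e i (z - x), r u k) \<in> K"
      proof (rule K_I[where z = x])
        show "(u j, k j) \<in> G j" if "j \<in> I" for j using that zy G(4) d by (auto simp: u_def k_def)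
        show "p (e i (z - x) j) = u j - x" if "j \<in> I" for j
          using p(3)[OF WD[OF zD]] linear_0[OF p(2)] by (auto simp: e_def u_def)
      qed
      from L(2)[OF this] have "L (e i (z - x)) \<le> r u k" .
      also have "r u k = a i * (y - c - \<phi> (z - x)) + (\<Sum>j\<in>I - {i}. a j * d)"
        unfolding r_def sum.remove[OF I(1) i] by (intro arg_cong2[of _ _ _ _ "(+)"] sum.cong) (auto simp: u_def k_def linear_0[OF \<phi>])
      also have "(\<Sum>j\<in>I - {i}. a j * d) \<le> (\<Sum>j\<in>I. a j * d)"
        using I(1) I(2) d by (intro sum_mono2) (auto simp: less_imp_le)
      also have "(\<Sum>j\<in>I. a j * d) = d" using I(3) by (simp add: sum_distrib_right[symmetric])
      finally show "L (e i (z - x)) \<le> a i * (y - c - \<phi> (z - x)) + d" by simp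
    qed
    then have "L (e i (z - x)) / a i \<le> y - c - \<phi> (z - x)" using I(2)[OF i] by (simp add: field_simps)
    then show ?thesis by (simp add: l_def)
  qed
  moreover have "(\<Sum>i\<in>I. a i * l i w) = \<phi> w" if w: "w \<in> ?W" for w
  proof -
    have le: "(\<Sum>i\<in>I. L (e i v)) \<le> 0" if v: "v \<in> ?W" for v
    proof (rule field_le_epsilon)
      fix d :: real assume d: "d > 0"
      \<comment> \<open>A common displacement \<open>v\<close> is realized by leaving all points at
        \<open>x\<close> and moving the base point to \<open>x - v\<close>, which need not lie in
        \<open>D\<close>. Using both \<open>w\<close> and \<open>- w\<close> gives equality.\<close>
      have "((\<Sum>i\<in>I. e i v), r (\<lambda>_. x) (\<lambda>_. c + d)) \<in> K"
      proof (rule K_I[where z = "x - v"])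
        show "(x, c + d) \<in> G j" if "j \<in> I" for j using G(4)[OF that d] .
        show "p ((\<Sum>i\<in>I. e i v) j) = x - (x - v)" if "j \<in> I" for j
          using that I(1) p(3)[OF v] by (simp add: sum_apply e_def)
      qed
      from L(2)[OF this] show "(\<Sum>i\<in>I. L (e i v)) \<le> 0 + d"
        using I(3) by (simp add: linear_sum[OF L(1)] r_def linear_0[OF \<phi>] sum_distrib_right[symmetric])
    qed
    have "e i (- w) = - e i w" for i by (auto simp: e_def)
    then have "(\<Sum>i\<in>I. L (e i w)) = 0"
      using le[OF w] le[OF span_neg[OF w]] by (simp add: linear_neg[OF L(1)] sum_negf)
    moreover have "(\<Sum>i\<in>I. a i * l i w) = sum a I * \<phi> w + (\<Sum>i\<in>I. L (e i w))"
      unfolding sum_distrib_right sum.distrib[symmetric] using I(2) by (intro sum.cong) (auto simp: l_def distrib_left less_imp_neq[symmetric])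
    ultimately show ?thesis by (simp add: I(3))
  qed
  ultimately show ?thesis by (intro exI[of _ l]) blast
qed

section \<open>Upper limits over the compactification\<close>

lemma ultrafilter_filtermap: "ultrafilter U \<Longrightarrow> ultrafilter (filtermap g U)"
  by (auto simp: ultrafilter_def eventually_filtermap filtermap_bot_iff)

text \<open>Each coordinate function has a limit along \<open>F\<close> in the compact interval.
  These limits are the coordinates of \<open>\<gamma>\<close>, and convergence in the cube is
  coordinatewise.\<close>

lemma ultrafilter_compactification:
  assumes F: "ultrafilter F" "F \<le> principal (topspace \<tau>)"
  shows "\<exists>\<gamma>\<in>compactification \<tau>. F \<in> nets_to \<tau> \<gamma>"
proof -
  have T: "eventually (\<lambda>t. t \<in> topspace \<tau>) F" using F(2) by (simp add: le_principal)
  have range: "\<psi> t \<in> {0..1}" if "\<psi> \<in> unit_cfuns \<tau>" "t \<in> topspace \<tau>" for \<psi> t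
    using that unfolding unit_cfuns_def continuous_map_def by auto
  define \<gamma> where "\<gamma> = (\<lambda>\<psi>\<in>unit_cfuns \<tau>. SOME l. l \<in> {0..1} \<and> (\<psi> \<longlongrightarrow> l) F)"
  have \<gamma>: "\<gamma> \<psi> \<in> {0..1} \<and> (\<psi> \<longlongrightarrow> \<gamma> \<psi>) F" if \<psi>: "\<psi> \<in> unit_cfuns \<tau>" for \<psi>
  proof -
    have "eventually (\<lambda>t. \<psi> t \<in> {0..1}) F" using T by eventually_elim (rule range[OF \<psi>])
    then have "\<exists>l. l \<in> {0..1} \<and> (\<psi> \<longlongrightarrow> l) F"
      using ultrafilter_converges[OF F(1) compact_Icc, of \<psi>] by blast
    from someI_ex[OF this] show ?thesis using \<psi> by (simp add: \<gamma>_def)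
  qed
  have lim: "limitin (cube \<tau>) (eval_at \<tau>) \<gamma> F"
    unfolding cube_def limitin_componentwise
  proof (intro conjI ballI)
    show "\<gamma> \<in> extensional (unit_cfuns \<tau>)" by (simp add: \<gamma>_def)
    show "\<forall>\<^sub>F t in F. eval_at \<tau> t \<in> topspace (product_topology (\<lambda>_. top_of_set {0..1}) (unit_cfuns \<tau>))"
      using T by eventually_elim (use range in \<open>auto simp: eval_at_def\<close>)
    fix \<psi> assume \<psi>: "\<psi> \<in> unit_cfuns \<tau>"
    have "eventually (\<lambda>t. eval_at \<tau> t \<psi> \<in> {0..1}) F"
      using T by eventually_elim (use \<psi> range in \<open>auto simp: eval_at_def\<close>)
    then show "limitin (top_of_set {0..1}) (\<lambda>t. eval_at \<tau> t \<psi>) (\<gamma> \<psi>) F"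
      using \<gamma>[OF \<psi>] \<psi> by (simp add: limitin_subtopology eval_at_def)
  qed
  have "\<gamma> \<in> compactification \<tau>"
    unfolding compactification_def in_closure_of
  proof (intro conjI allI impI)
    show "\<gamma> \<in> topspace (cube \<tau>)" using lim by (simp add: limitin_def)
    fix S assume "\<gamma> \<in> S \<and> openin (cube \<tau>) S"
    then have "\<forall>\<^sub>F t in F. eval_at \<tau> t \<in> S" using lim by (simp add: limitin_def)
    with T have "\<forall>\<^sub>F t in F. t \<in> topspace \<tau> \<and> eval_at \<tau> t \<in> S" by eventually_elim simp
    then obtain t where "t \<in> topspace \<tau> \<and> eval_at \<tau> t \<in> S"
      using eventually_happens' F(1) unfolding ultrafilter_def by blast
    then show "\<exists>y. y \<in> eval_at \<tau> ` topspace \<tau> \<and> y \<in> S" by blast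
  qed
  then show ?thesis using lim F by (auto simp: nets_to_def ultrafilter_def)
qed

lemma Limsup_le_sup_fun:
  assumes "F \<le> principal (topspace \<tau>)"
  shows "Limsup F (\<lambda>t. f t z) \<le> sup_fun \<tau> f z"
proof (rule Limsup_bounded)
  show "\<forall>\<^sub>F t in F. f t z \<le> sup_fun \<tau> f z"
    using assms unfolding le_principal sup_fun_def by eventually_elim (rule SUP_upper)
qed

lemma f_tilde_le_sup_fun: "f_tilde \<tau> f x \<gamma> z \<le> sup_fun \<tau> f z"
  unfolding f_tilde_def by (intro SUP_least Limsup_le_sup_fun) (simp add: nets_to_def)

lemma f_tilde_self:
  assumes "F \<in> nets_to \<tau> \<gamma>" "((\<lambda>t. f t x) \<longlongrightarrow> sup_fun \<tau> f x) F"
  shows "f_tilde \<tau> f x \<gamma> x = sup_fun \<tau> f x"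
proof (rule antisym[OF f_tilde_le_sup_fun])
  have "Limsup F (\<lambda>t. f t x) = sup_fun \<tau> f x"
    using assms by (intro lim_imp_Limsup) (simp_all add: nets_to_def)
  then show "sup_fun \<tau> f x \<le> f_tilde \<tau> f x \<gamma> x"
    unfolding f_tilde_def using assms by (intro SUP_upper2[of F]) auto
qed

section \<open>The intersection is contained in the subdifferential\<close>

lemma subdifferential_f_tilde_le:
  assumes fin: "\<bar>sup_fun \<tau> f x\<bar> \<noteq> \<infinity>" and L: "x \<in> L" "y \<in> L" "sup_fun \<tau> f y < \<infinity>"
    and \<psi>: "\<psi> \<in> subdifferential (\<lambda>z. f_tilde \<tau> f x \<gamma> z + eindicator (L \<inter> edom (sup_fun \<tau> f)) z) x"
  shows "sup_fun \<tau> f x + ereal (\<psi> (y - x)) \<le> sup_fun \<tau> f y"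
proof -
  have x: "x \<in> L \<inter> edom (sup_fun \<tau> f)" "y \<in> L \<inter> edom (sup_fun \<tau> f)"
    using fin L by (auto simp: edom_def)
  have fin': "\<bar>f_tilde \<tau> f x \<gamma> x\<bar> \<noteq> \<infinity>"
    and le: "f_tilde \<tau> f x \<gamma> x + ereal (\<psi> (y - x)) \<le> f_tilde \<tau> f x \<gamma> y"
    using \<psi> x by (auto simp: subdifferential_def eindicator_def split: if_splits dest!: spec[of _ y])
  \<comment> \<open>Without an admissible net the supremum would be -\<infinity> at
    \<open>x\<close>, against finiteness. One such net makes \<open>f_tilde\<close> and
    \<open>sup_fun\<close> agree at \<open>x\<close>.\<close>
  have "{F \<in> nets_to \<tau> \<gamma>. ((\<lambda>t. f t x) \<longlongrightarrow> sup_fun \<tau> f x) F} \<noteq> {}"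
  proof
    assume "{F \<in> nets_to \<tau> \<gamma>. ((\<lambda>t. f t x) \<longlongrightarrow> sup_fun \<tau> f x) F} = {}"
    then have "f_tilde \<tau> f x \<gamma> x = -\<infinity>"
      unfolding f_tilde_def by (simp only: image_empty Sup_empty bot_ereal_def)
    then show False using fin' by simp
  qed
  then obtain F where "F \<in> nets_to \<tau> \<gamma>" "((\<lambda>t. f t x) \<longlongrightarrow> sup_fun \<tau> f x) F" by blast
  then have "f_tilde \<tau> f x \<gamma> x = sup_fun \<tau> f x" by (rule f_tilde_self)
  with le have "sup_fun \<tau> f x + ereal (\<psi> (y - x)) \<le> f_tilde \<tau> f x \<gamma> y" by simp
  then show ?thesis using f_tilde_le_sup_fun by (rule order_trans)
qed

lemma convex_dual_space: "convex (dual_space :: ('a::separated_lcs \<Rightarrow> real) set)"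
  unfolding convex_def
proof (intro ballI allI impI)
  fix \<phi> \<psi> :: "'a \<Rightarrow> real" and u v :: real assume "\<phi> \<in> dual_space" "\<psi> \<in> dual_space"
  then have "(\<lambda>y. \<Sum>b\<in>UNIV. (if b then u else v) * (if b then \<phi> else \<psi>) y) \<in> dual_space"
    by (intro dual_space_sum) auto
  then show "u *\<^sub>R \<phi> + v *\<^sub>R \<psi> \<in> dual_space"
    by (simp add: UNIV_bool scaleR_fun_def plus_fun_def add.commute)
qed

text \<open>The inequality at a point \<open>y\<close> needs only the subspace spanned by
  \<open>x\<close> and \<open>y\<close>: it holds for every generator of the hull and is preserved
  by convex combinations.\<close>

lemma Inter_hull_subset_subdifferential:
  fixes f :: "'t \<Rightarrow> 'a::separated_lcs \<Rightarrow> ereal"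
  assumes \<phi>: "\<And>L. L \<in> fin_dim_subspaces x \<Longrightarrow> \<phi> \<in> convex hull (\<Union>\<gamma>\<in>active \<tau> f x.
    subdifferential (\<lambda>z. f_tilde \<tau> f x \<gamma> z + eindicator (L \<inter> edom (sup_fun \<tau> f)) z) x)"
  shows "\<phi> \<in> subdifferential (sup_fun \<tau> f) x"
proof -
  define A where "A = (\<lambda>L. \<Union>\<gamma>\<in>active \<tau> f x.
    subdifferential (\<lambda>z. f_tilde \<tau> f x \<gamma> z + eindicator (L \<inter> edom (sup_fun \<tau> f)) z) x)"
  have span: "span {x, y} \<in> fin_dim_subspaces x" for y
    unfolding fin_dim_subspaces_def by (auto intro!: exI[of _ "{x, y}"] span_base)
  have hull: "\<phi> \<in> convex hull (A (span {x, y}))" for y using \<phi>[OF span] by (simp add: A_def)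
  \<comment> \<open>The hull of the empty set is empty, and an active index exists only where
    \<open>sup_fun\<close> is finite.\<close>
  have "active \<tau> f x \<noteq> {}"
  proof
    assume "active \<tau> f x = {}"
    then show False using hull[of x] by (simp add: A_def)
  qed
  then have fin: "\<bar>sup_fun \<tau> f x\<bar> \<noteq> \<infinity>" by (auto simp: active_def split: if_splits)
  have Ad: "A L \<subseteq> dual_space" for L by (auto simp: A_def subdifferential_def split: if_splits)
  then have dual: "\<phi> \<in> dual_space"
    using hull[of x] hull_minimal[of "A (span {x, x})" dual_space convex] Ad convex_dual_space by blast
  have "sup_fun \<tau> f x + ereal (\<phi> (y - x)) \<le> sup_fun \<tau> f y" for y
  proof (cases "sup_fun \<tau> f y < \<infinity>")
    case True
    define H where "H = {\<psi>. sup_fun \<tau> f x + ereal (\<psi> (y - x)) \<le> sup_fun \<tau> f y}"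
    have "A (span {x, y}) \<subseteq> H"
    proof
      fix \<psi> assume "\<psi> \<in> A (span {x, y})"
      then obtain \<gamma> where "\<psi> \<in> subdifferential (\<lambda>z. f_tilde \<tau> f x \<gamma> z + eindicator (span {x, y} \<inter> edom (sup_fun \<tau> f)) z) x"
        unfolding A_def by blast
      then have "sup_fun \<tau> f x + ereal (\<psi> (y - x)) \<le> sup_fun \<tau> f y"
        by (intro subdifferential_f_tilde_le[OF fin _ _ True, of "span {x, y}"]) (auto intro: span_base)
      then show "\<psi> \<in> H" by (simp add: H_def)
    qed
    moreover have "convex H"
    proof -
      obtain c where c: "sup_fun \<tau> f x = ereal c" using fin by (cases "sup_fun \<tau> f x") auto
      show ?thesis
      proof (cases "sup_fun \<tau> f y")
        case (real d)
        then have "H = {\<psi>. \<psi> (y - x) \<le> d - c}" by (auto simp: H_def c)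
        then show ?thesis
          by (auto simp: convex_def scaleR_fun_def intro!: convex_bound_le)
      qed (use True in \<open>auto simp: H_def c\<close>)
    qed
    ultimately have "convex hull (A (span {x, y})) \<subseteq> H" by (rule hull_minimal)
    then show ?thesis using hull[of y] by (auto simp: H_def)
  qed auto
  then show ?thesis using fin dual by (simp add: subdifferential_def)
qed

section \<open>Convexity of the regularizations, the domain and the truncations\<close>

text \<open>A strict upper bound on an upper limit holds eventually for the functions themselves, so
  convexity of each \<open>f t\<close> applies index by index along every net, and values
  -\<infinity> cause no trouble.\<close>

lemma convex_strict_epigraph_f_tilde:
  assumes f: "\<And>t. t \<in> topspace \<tau> \<Longrightarrow> econvex (f t)" and D: "convex D"
  shows "convex {(z, r). z \<in> D \<and> f_tilde \<tau> f x \<gamma> z < ereal r}"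
  unfolding convex_def
proof (intro ballI allI impI)
  fix p q and u v :: real
  assume "p \<in> {(z, r). z \<in> D \<and> f_tilde \<tau> f x \<gamma> z < ereal r}" "q \<in> {(z, r). z \<in> D \<and> f_tilde \<tau> f x \<gamma> z < ereal r}"
    and uv: "0 \<le> u" "0 \<le> v" "u + v = 1"
  then obtain z r z' r' where p: "p = (z, r)" "z \<in> D" "f_tilde \<tau> f x \<gamma> z < ereal r"
    and q: "q = (z', r')" "z' \<in> D" "f_tilde \<tau> f x \<gamma> z' < ereal r'" by auto
  \<comment> \<open>Bounding an upper limit yields only a weak inequality; the gaps
    \<open>s < r\<close> and \<open>s' < r'\<close> restore strictness.\<close>
  obtain s where s: "f_tilde \<tau> f x \<gamma> z < ereal s" "s < r" using ereal_dense2[OF p(3)] by auto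
  obtain s' where s': "f_tilde \<tau> f x \<gamma> z' < ereal s'" "s' < r'" using ereal_dense2[OF q(3)] by auto
  have "f_tilde \<tau> f x \<gamma> (u *\<^sub>R z + v *\<^sub>R z') \<le> ereal (u * s + v * s')"
    unfolding f_tilde_def
  proof (rule SUP_least)
    fix F assume F: "F \<in> {F \<in> nets_to \<tau> \<gamma>. ((\<lambda>t. f t x) \<longlongrightarrow> sup_fun \<tau> f x) F}"
    then have "Limsup F (\<lambda>t. f t z) \<le> f_tilde \<tau> f x \<gamma> z" "Limsup F (\<lambda>t. f t z') \<le> f_tilde \<tau> f x \<gamma> z'"
      unfolding f_tilde_def by (auto intro: SUP_upper)
    then have "Limsup F (\<lambda>t. f t z) < ereal s" "Limsup F (\<lambda>t. f t z') < ereal s'"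
      using s(1) s'(1) by simp_all
    then have ev: "\<forall>\<^sub>F t in F. f t z < ereal s" "\<forall>\<^sub>F t in F. f t z' < ereal s'"
      by (auto dest: Limsup_lessD)
    have T: "eventually (\<lambda>t. t \<in> topspace \<tau>) F" using F by (simp add: nets_to_def le_principal)
    show "Limsup F (\<lambda>t. f t (u *\<^sub>R z + v *\<^sub>R z')) \<le> ereal (u * s + v * s')"
    proof (rule Limsup_bounded)
      show "\<forall>\<^sub>F t in F. f t (u *\<^sub>R z + v *\<^sub>R z') \<le> ereal (u * s + v * s')"
        using ev T
      proof eventually_elim
        case (elim t)
        then have "u *\<^sub>R (z, s) + v *\<^sub>R (z', s') \<in> {(x, r). f t x \<le> ereal r}"
          using uv by (intro convexD[OF f[OF elim(3), unfolded econvex_def]]) auto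
        then show ?case by simp
      qed
    qed
  qed
  also have "u * s + v * s' < u * r + v * r'"
  proof (cases "u = 0")
    case True
    then show ?thesis using uv s'(2) by simp
  next
    case False
    then have "u * s < u * r" using uv s(2) by simp
    moreover have "v * s' \<le> v * r'" using uv s'(2) by (simp add: mult_left_mono)
    ultimately show ?thesis by simp
  qed
  then have "ereal (u * s + v * s') < ereal (u * r + v * r')" by simp
  finally show "u *\<^sub>R p + v *\<^sub>R q \<in> {(z, r). z \<in> D \<and> f_tilde \<tau> f x \<gamma> z < ereal r}"
    using convexD[OF D p(2) q(2) uv] by (simp add: p(1) q(1))
qed

lemma convex_edom_sup_fun:
  assumes f: "\<And>t. t \<in> topspace \<tau> \<Longrightarrow> econvex (f t)"
  shows "convex (edom (sup_fun \<tau> f))"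
  unfolding convex_def
proof (intro ballI allI impI)
  fix z z' and u v :: real
  assume z: "z \<in> edom (sup_fun \<tau> f)" "z' \<in> edom (sup_fun \<tau> f)" and uv: "0 \<le> u" "0 \<le> v" "u + v = 1"
  obtain s where s: "sup_fun \<tau> f z < ereal s" using z ereal_dense2[of "sup_fun \<tau> f z" \<infinity>] by (auto simp: edom_def)
  obtain s' where s': "sup_fun \<tau> f z' < ereal s'" using z ereal_dense2[of "sup_fun \<tau> f z'" \<infinity>] by (auto simp: edom_def)
  have "sup_fun \<tau> f (u *\<^sub>R z + v *\<^sub>R z') \<le> ereal (u * s + v * s')"
    unfolding sup_fun_def
  proof (rule SUP_least)
    fix t assume t: "t \<in> topspace \<tau>"
    have "f t z \<le> sup_fun \<tau> f z" "f t z' \<le> sup_fun \<tau> f z'" using t by (auto simp: sup_fun_def intro: SUP_upper)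
    then have "f t z \<le> ereal s" "f t z' \<le> ereal s'" using s s' by auto
    then have "u *\<^sub>R (z, s) + v *\<^sub>R (z', s') \<in> {(x, r). f t x \<le> ereal r}"
      using uv by (intro convexD[OF f[OF t, unfolded econvex_def]]) auto
    then show "f t (u *\<^sub>R z + v *\<^sub>R z') \<le> ereal (u * s + v * s')" by simp
  qed
  then show "u *\<^sub>R z + v *\<^sub>R z' \<in> edom (sup_fun \<tau> f)" unfolding edom_def by (auto intro: le_less_trans)
qed

lemma real_of_ereal_max:
  fixes r :: ereal
  assumes "r < \<infinity>"
  shows "ereal (real_of_ereal (max r (ereal m))) = max r (ereal m)"
  using assms by (cases r) (auto simp: max_def)

text \<open>The maximum with a constant stays convex and is real-valued on \<open>D\<close>.
  Subtracting the linear part leaves a constant lower bound, as \<open>finite_minimax\<close>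
  requires.\<close>

lemma convex_on_truncation:
  fixes g :: "'b::real_vector \<Rightarrow> ereal"
  assumes g: "econvex g" and D: "convex D" "\<And>z. z \<in> D \<Longrightarrow> g z < \<infinity>" and \<phi>: "linear \<phi>"
  shows "convex_on D (\<lambda>z. real_of_ereal (max (g z) (ereal m)) - \<phi> (z - x))"
  unfolding convex_on_def
proof (intro conjI ballI allI impI D(1))
  fix z z' and u v :: real
  assume z: "z \<in> D" "z' \<in> D" and uv: "0 \<le> u" "0 \<le> v" "u + v = 1"
  define k where "k = (\<lambda>z. real_of_ereal (max (g z) (ereal m)))"
  have k: "ereal (k z) = max (g z) (ereal m)" if "z \<in> D" for z
    unfolding k_def by (rule real_of_ereal_max[OF D(2)[OF that]])
  have le: "g z \<le> ereal (k z)" "m \<le> k z" if "z \<in> D" for z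
    using k[OF that] by (simp, metis ereal_less_eq(3) max.cobounded2)
  let ?w = "u *\<^sub>R z + v *\<^sub>R z'"
  have w: "?w \<in> D" using convexD[OF D(1) z uv] .
  have "u *\<^sub>R (z, k z) + v *\<^sub>R (z', k z') \<in> {(x, r). g x \<le> ereal r}"
    using uv z le(1) by (intro convexD[OF g[unfolded econvex_def]]) auto
  then have 1: "g ?w \<le> ereal (u * k z + v * k z')" by simp
  have "m = u * m + v * m" using uv by (simp add: distrib_right[symmetric])
  also have "\<dots> \<le> u * k z + v * k z'" using uv le(2) z by (intro add_mono mult_left_mono)
  finally have "ereal (k ?w) \<le> ereal (u * k z + v * k z')" unfolding k[OF w] using 1 by simp
  moreover have "\<phi> (?w - x) = u * \<phi> (z - x) + v * \<phi> (z' - x)"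
  proof -
    have "\<phi> (?w - x) = \<phi> (?w - (u + v) *\<^sub>R x)" using uv by simp
    then show ?thesis by (simp add: linear_add[OF \<phi>] linear_diff[OF \<phi>] linear_scale[OF \<phi>] algebra_simps)
  qed
  ultimately show "real_of_ereal (max (g ?w) (ereal m)) - \<phi> (?w - x)
    \<le> u * (real_of_ereal (max (g z) (ereal m)) - \<phi> (z - x)) + v * (real_of_ereal (max (g z') (ereal m)) - \<phi> (z' - x))"
    unfolding k_def by (simp add: algebra_simps)
qed

text \<open>The indices from \<open>finite_minimax\<close> are passed to the limit along an ultrafilter on the pairs \<open>(P, k)\<close>,
  where \<open>P\<close> runs through the finite subsets of \<open>D\<close> and the functions are truncated below at \<open>- k\<close>, since
  they may take the value \<open>-\<infinity>\<close>. Indices of vanishing limit weight are discarded: as \<open>f t\<close> is bounded above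
  by \<open>sup_fun \<tau> f\<close>, they do not contribute.\<close>

lemma finitely_many_active_indices:
  fixes f :: "'t \<Rightarrow> 'a::separated_lcs \<Rightarrow> ereal"
  assumes T: "topspace \<tau> \<noteq> {}" and f: "\<And>t. t \<in> topspace \<tau> \<Longrightarrow> econvex (f t)"
    and \<phi>: "linear \<phi>" and B: "finite B" and D: "D = span B \<inter> edom (sup_fun \<tau> f)" "x \<in> D"
    and c: "sup_fun \<tau> f x = ereal c"
    and sub: "\<And>z. ereal (c + \<phi> (z - x)) \<le> sup_fun \<tau> f z"
  shows "\<exists>a \<gamma>. (\<forall>i\<le>card B. 0 \<le> a i) \<and> sum a {..card B} = 1 \<and>
    (\<forall>i\<le>card B. 0 < a i \<longrightarrow> \<gamma> i \<in> active \<tau> f x \<and> f_tilde \<tau> f x (\<gamma> i) x = sup_fun \<tau> f x) \<and>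
    (\<forall>z\<in>D. \<forall>y. (\<forall>i\<le>card B. 0 < a i \<longrightarrow> f_tilde \<tau> f x (\<gamma> i) z < ereal (y i)) \<longrightarrow>
      c + \<phi> (z - x) \<le> (\<Sum>i | i \<le> card B \<and> 0 < a i. a i * y i))"
proof -
  define n where "n = card B"
  define m where "m = (\<lambda>(k::nat) t z. real_of_ereal (max (f t z) (ereal (- real k))))"
  define \<epsilon> where "\<epsilon> = (\<lambda>k. 1 / real (Suc k))"
  have D_conv: "convex D"
    unfolding D(1) by (intro convex_Int subspace_imp_convex subspace_span convex_edom_sup_fun f)
  have f_le: "f t z \<le> sup_fun \<tau> f z" if "t \<in> topspace \<tau>" for t z
    unfolding sup_fun_def using that by (rule SUP_upper)
  have D_fin: "f t z < \<infinity>" if "z \<in> D" "t \<in> topspace \<tau>" for t z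
    using that f_le[OF that(2), of z] by (auto simp: D(1) edom_def)
  have m_eq: "ereal (m k t z) = max (f t z) (ereal (- real k))" if "z \<in> D" "t \<in> topspace \<tau>" for k t z
    unfolding m_def by (rule real_of_ereal_max[OF D_fin[OF that]])
  define good where "good = (\<lambda>P k s a. (\<forall>i\<le>n. s i \<in> topspace \<tau> \<and> (0::real) \<le> a i) \<and> sum a {..n} = 1 \<and>
    (\<forall>z\<in>P. c - \<epsilon> k \<le> (\<Sum>i\<le>n. a i * (m k (s i) z - \<phi> (z - x)))))"
  have ex: "\<exists>s a. good P k s a" if P: "finite P" "P \<subseteq> D" "P \<noteq> {}" for P k
    unfolding good_def n_def
  proof (rule finite_minimax[OF B _ _ _ P])
    show "D \<subseteq> span B" by (simp add: D(1))
    show "convex_on D (\<lambda>z. m k t z - \<phi> (z - x))" if "t \<in> topspace \<tau>" for t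
      unfolding m_def by (rule convex_on_truncation[OF f[OF that] D_conv D_fin[OF _ that] \<phi>])
    fix z assume z: "z \<in> D"
    \<comment> \<open>The slack \<open>\<epsilon> k\<close> makes the inequality strict, so that
      some single index already exceeds the bound.\<close>
    have "ereal (c - \<epsilon> k + \<phi> (z - x)) < ereal (c + \<phi> (z - x))" by (simp add: \<epsilon>_def)
    then have "ereal (c - \<epsilon> k + \<phi> (z - x)) < sup_fun \<tau> f z" using sub by (rule less_le_trans)
    then obtain t where t: "t \<in> topspace \<tau>" "ereal (c - \<epsilon> k + \<phi> (z - x)) < f t z"
      unfolding sup_fun_def less_SUP_iff by blast
    have "f t z \<le> ereal (m k t z)" using m_eq[OF z t(1)] by simp
    with t(2) have "ereal (c - \<epsilon> k + \<phi> (z - x)) < ereal (m k t z)" by (rule less_le_trans)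
    then show "\<exists>t\<in>topspace \<tau>. c - \<epsilon> k < m k t z - \<phi> (z - x)" using t(1) by (intro bexI[of _ t]) auto
  qed
  define sa where "sa = (\<lambda>p. SOME sa. good (fst p) (snd p) (fst sa) (snd sa))"
  define s where "s = (\<lambda>p. fst (sa p))"
  define a where "a = (\<lambda>p. snd (sa p))"
  have good: "good (fst p) (snd p) (s p) (a p)" if p: "finite (fst p)" "fst p \<subseteq> D" "fst p \<noteq> {}" for p
  proof -
    obtain s' a' where "good (fst p) (snd p) s' a'" using ex[OF p] by blast
    then have "good (fst p) (snd p) (fst (s', a')) (snd (s', a'))" by simp
    then show ?thesis unfolding s_def a_def sa_def by (rule someI)
  qed
  have "finite_subsets_at_top D \<times>\<^sub>F sequentially \<noteq> bot" by (simp add: prod_filter_eq_bot)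
  then obtain U where U: "U \<le> finite_subsets_at_top D \<times>\<^sub>F sequentially" "ultrafilter U"
    by (rule ultrafilter_exists)
  have Ub: "U \<noteq> bot" using U(2) by (simp add: ultrafilter_def)
  have fst_U: "filterlim fst (finite_subsets_at_top D) U" and snd_U: "filterlim snd sequentially U"
    using filterlim_mono[OF filterlim_fst order_refl U(1)] filterlim_mono[OF filterlim_snd order_refl U(1)] by blast+
  have "eventually (\<lambda>P. finite P \<and> P \<subseteq> D \<and> z \<in> P) (finite_subsets_at_top D)" if "z \<in> D" for z
    unfolding eventually_finite_subsets_at_top using that by (intro exI[of _ "{z}"]) auto
  then have evP: "eventually (\<lambda>p. finite (fst p) \<and> fst p \<subseteq> D \<and> z \<in> fst p) U" if "z \<in> D" for z
    using eventually_compose_filterlim[OF _ fst_U] that by blast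
  have ev_good: "eventually (\<lambda>p. good (fst p) (snd p) (s p) (a p) \<and> z \<in> fst p) U" if "z \<in> D" for z
    using evP[OF that] by eventually_elim (use good in blast)
  have evk: "eventually (\<lambda>p. C < real (snd p)) U" for C
    using eventually_compose_filterlim[OF _ snd_U] filterlim_real_sequentially[unfolded filterlim_at_top_dense] by blast
  have \<epsilon>0: "((\<lambda>p. \<epsilon> (snd p)) \<longlongrightarrow> 0) U"
    unfolding \<epsilon>_def by (rule filterlim_compose[OF LIMSEQ_Suc[OF lim_1_over_n] snd_U])
  define A where "A = (\<lambda>i. SOME l. ((\<lambda>p. a p i) \<longlongrightarrow> l) U)"
  have A: "((\<lambda>p. a p i) \<longlongrightarrow> A i) U" if i: "i \<le> n" for i
  proof -
    have "eventually (\<lambda>p. a p i \<in> {0..1}) U"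
      using ev_good[OF D(2)]
    proof eventually_elim
      case (elim p)
      then have g: "\<And>j. j \<le> n \<Longrightarrow> 0 \<le> a p j" "sum (a p) {..n} = 1" unfolding good_def by blast+
      have "a p i \<le> sum (a p) {..n}" using i g(1) by (intro member_le_sum) auto
      then show ?case using g i by simp
    qed
    then have "\<exists>l. ((\<lambda>p. a p i) \<longlongrightarrow> l) U"
      using ultrafilter_converges[OF U(2) compact_Icc, of "\<lambda>p. a p i"] by blast
    then show ?thesis unfolding A_def by (rule someI_ex)
  qed
  have A0: "0 \<le> A i" if i: "i \<le> n" for i
  proof (rule tendsto_lowerbound[OF A[OF i] _ Ub])
    show "\<forall>\<^sub>F p in U. 0 \<le> a p i" using ev_good[OF D(2)] by eventually_elim (use i in \<open>simp add: good_def\<close>)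
  qed
  have A1: "sum A {..n} = 1"
  proof (rule tendsto_unique[OF Ub])
    show "((\<lambda>p. sum (a p) {..n}) \<longlongrightarrow> sum A {..n}) U" using A by (intro tendsto_sum) auto
    have "\<forall>\<^sub>F p in U. sum (a p) {..n} = 1" using ev_good[OF D(2)] by eventually_elim (simp add: good_def)
    then show "((\<lambda>p. sum (a p) {..n}) \<longlongrightarrow> 1) U" by (rule tendsto_eventually)
  qed
  define F where "F = (\<lambda>i. filtermap (\<lambda>p. s p i) U)"
  have F: "ultrafilter (F i)" for i unfolding F_def by (rule ultrafilter_filtermap[OF U(2)])
  have sT: "eventually (\<lambda>p. s p i \<in> topspace \<tau>) U" if "i \<le> n" for i
    using ev_good[OF D(2)] by eventually_elim (use that in \<open>simp add: good_def\<close>)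
  have FT: "F i \<le> principal (topspace \<tau>)" if "i \<le> n" for i
    using sT[OF that] by (simp add: F_def le_principal eventually_filtermap)
  define \<gamma> where "\<gamma> = (\<lambda>i. SOME \<gamma>. \<gamma> \<in> compactification \<tau> \<and> F i \<in> nets_to \<tau> \<gamma>)"
  have \<gamma>: "\<gamma> i \<in> compactification \<tau> \<and> F i \<in> nets_to \<tau> (\<gamma> i)" if "i \<le> n" for i
  proof -
    have "\<exists>\<gamma>. \<gamma> \<in> compactification \<tau> \<and> F i \<in> nets_to \<tau> \<gamma>"
      using ultrafilter_compactification[OF F FT[OF that]] by blast
    then show ?thesis unfolding \<gamma>_def by (rule someI_ex)
  qed
  \<comment> \<open>The deficits \<open>a p j * (c - m k (s p j) x)\<close> are eventually
    nonnegative with sum at most \<open>\<epsilon> k\<close>. Once \<open>a p i\<close> exceeds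
    \<open>A i / 2\<close>, the deficit of index \<open>i\<close> alone forces its value at
    \<open>x\<close> above any \<open>r < c\<close>.\<close>
  have lim: "((\<lambda>t. f t x) \<longlongrightarrow> sup_fun \<tau> f x) (F i)" if i: "i \<le> n" "0 < A i" for i
    unfolding c
  proof (rule order_tendstoI)
    fix y :: ereal assume "ereal c < y"
    moreover have "\<forall>\<^sub>F t in F i. f t x \<le> ereal c"
      using FT[OF i(1)] f_le[of _ x] unfolding le_principal c by (auto elim: eventually_mono)
    ultimately show "\<forall>\<^sub>F t in F i. f t x < y" by (auto elim!: eventually_mono)
  next
    fix y :: ereal assume "y < ereal c"
    then obtain r where r: "y < ereal r" "r < c" using ereal_dense2[of y "ereal c"] by auto
    have 1: "\<forall>\<^sub>F p in U. A i / 2 < a p i" using i by (intro order_tendstoD(1)[OF A]) auto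
    have 2: "\<forall>\<^sub>F p in U. \<epsilon> (snd p) < A i / 2 * (c - r)" using i r by (intro order_tendstoD(2)[OF \<epsilon>0]) auto
    have "\<forall>\<^sub>F p in U. y < f (s p i) x"
      using 1 2 ev_good[OF D(2)] evk[of "- r"] evk[of "- c"]
    proof eventually_elim
      case (elim p)
      let ?k = "snd p"
      have g: "\<And>j. j \<le> n \<Longrightarrow> s p j \<in> topspace \<tau> \<and> 0 \<le> a p j" "sum (a p) {..n} = 1"
        "c - \<epsilon> ?k \<le> (\<Sum>j\<le>n. a p j * (m ?k (s p j) x - \<phi> (x - x)))"
        using elim(3) unfolding good_def by blast+
      \<comment> \<open>The truncation level lies below \<open>c\<close>, so truncation keeps the
        values at \<open>x\<close> at most \<open>c\<close>.\<close>
      have mc: "m ?k (s p j) x \<le> c" if "j \<le> n" for j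
      proof -
        have "ereal (m ?k (s p j) x) \<le> ereal c"
          unfolding m_eq[OF D(2) g(1)[OF that, THEN conjunct1]] using f_le[of "s p j" x] g(1)[OF that] elim(5) by (simp add: c)
        then show ?thesis by simp
      qed
      have "a p i * (c - m ?k (s p i) x) \<le> (\<Sum>j\<le>n. a p j * (c - m ?k (s p j) x))"
        using i(1) g(1) mc by (intro member_le_sum) auto
      also have "\<dots> = c - (\<Sum>j\<le>n. a p j * m ?k (s p j) x)"
        using g(2) by (simp add: right_diff_distrib sum_subtractf sum_distrib_right[symmetric])
      also have "\<dots> \<le> \<epsilon> ?k" using g(3) by (simp add: linear_0[OF \<phi>])
      finally have le: "a p i * (c - m ?k (s p i) x) < A i / 2 * (c - r)" using elim(2) by simp
      have "r < m ?k (s p i) x"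
      proof (rule ccontr)
        assume "\<not> ?thesis"
        then have "A i / 2 * (c - r) \<le> a p i * (c - m ?k (s p i) x)"
          using elim(1) r i by (intro mult_mono) auto
        then show False using le by simp
      qed
      then have "ereal r < max (f (s p i) x) (ereal (- real ?k))"
        unfolding m_eq[OF D(2) g(1)[OF i(1), THEN conjunct1], symmetric] by simp
      \<comment> \<open>The level \<open>- k\<close> lies below \<open>r\<close>, so the maximum
        exceeds \<open>r\<close> through \<open>f\<close> itself.\<close>
      then have "ereal r < f (s p i) x" using elim(4) by (auto simp: max_def split: if_splits)
      then show ?case using r(1) by (rule less_trans[rotated])
    qed
    then show "\<forall>\<^sub>F t in F i. y < f t x" by (simp add: F_def eventually_filtermap)
  qed
  have act: "\<gamma> i \<in> active \<tau> f x" if i: "i \<le> n" "0 < A i" for i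
  proof -
    have "Limsup (F i) (\<lambda>t. f t x) = sup_fun \<tau> f x" using F[of i] lim[OF i] by (intro lim_imp_Limsup) (simp add: ultrafilter_def)
    then have "sup_fun \<tau> f x \<le> f_hat \<tau> f (\<gamma> i) x"
      unfolding f_hat_def using \<gamma>[OF i(1)] by (intro SUP_upper2[of "F i"]) auto
    then show ?thesis using \<gamma>[OF i(1)] by (simp add: active_def c)
  qed
  have "c + \<phi> (z - x) \<le> (\<Sum>i | i \<le> n \<and> 0 < A i. A i * y i)"
    if z: "z \<in> D" and y: "\<And>i. i \<le> n \<Longrightarrow> 0 < A i \<Longrightarrow> f_tilde \<tau> f x (\<gamma> i) z < ereal (y i)" for z y
  proof -
    obtain d where d: "sup_fun \<tau> f z = ereal d"
      using z sub[of z] by (cases "sup_fun \<tau> f z") (auto simp: D(1) edom_def)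
    \<comment> \<open>Where the limit weight vanishes, any finite eventual bound will do;
      \<open>d\<close> is the value of \<open>sup_fun\<close> at \<open>z\<close>.\<close>
    define Y where "Y = (\<lambda>i. if 0 < A i then y i else d)"
    have mY: "\<forall>\<^sub>F p in U. m (snd p) (s p i) z \<le> Y i" if i: "i \<le> n" for i
    proof -
      have "\<forall>\<^sub>F p in U. f (s p i) z \<le> ereal (Y i)"
      proof (cases "0 < A i")
        case True
        have "Limsup (F i) (\<lambda>t. f t z) \<le> f_tilde \<tau> f x (\<gamma> i) z"
          unfolding f_tilde_def using \<gamma>[OF i] lim[OF i True] by (intro SUP_upper) simp
        then have "Limsup (F i) (\<lambda>t. f t z) < ereal (y i)" using y[OF i True] by (rule le_less_trans)
        then have "\<forall>\<^sub>F t in F i. f t z < ereal (y i)" by (rule Limsup_lessD)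
        then show ?thesis using True by (auto simp: F_def eventually_filtermap Y_def elim!: eventually_mono)
      next
        case False
        show ?thesis using sT[OF i] by eventually_elim (use f_le[of _ z] False in \<open>simp add: Y_def d\<close>)
      qed
      then show ?thesis
        using evk[of "- Y i"] sT[OF i]
      proof eventually_elim
        case (elim p)
        then have "ereal (m (snd p) (s p i) z) \<le> ereal (Y i)" unfolding m_eq[OF z elim(3)] by simp
        then show ?case by simp
      qed
    qed
    then have "\<forall>\<^sub>F p in U. \<forall>i\<in>{..n}. m (snd p) (s p i) z \<le> Y i"
      by (intro eventually_ball_finite) auto
    then have le: "\<forall>\<^sub>F p in U. c - \<epsilon> (snd p) \<le> (\<Sum>i\<le>n. a p i * (Y i - \<phi> (z - x)))"
      using ev_good[OF z]
    proof eventually_elim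
      case (elim p)
      then have g: "\<And>j. j \<le> n \<Longrightarrow> 0 \<le> a p j"
        "c - \<epsilon> (snd p) \<le> (\<Sum>i\<le>n. a p i * (m (snd p) (s p i) z - \<phi> (z - x)))" unfolding good_def by blast+
      note g(2)
      also have "\<dots> \<le> (\<Sum>i\<le>n. a p i * (Y i - \<phi> (z - x)))"
        using elim(1) g(1) by (intro sum_mono mult_left_mono) auto
      finally show ?case .
    qed
    have "c - 0 \<le> (\<Sum>i\<le>n. A i * (Y i - \<phi> (z - x)))"
    proof (rule tendsto_le[OF Ub _ _ le])
      show "((\<lambda>p. \<Sum>i\<le>n. a p i * (Y i - \<phi> (z - x))) \<longlongrightarrow> (\<Sum>i\<le>n. A i * (Y i - \<phi> (z - x)))) U"
        using A by (intro tendsto_sum tendsto_mult tendsto_const) auto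
      show "((\<lambda>p. c - \<epsilon> (snd p)) \<longlongrightarrow> c - 0) U" by (intro tendsto_diff tendsto_const \<epsilon>0)
    qed
    also have "\<dots> = (\<Sum>i\<le>n. A i * Y i) - \<phi> (z - x)"
      using A1 by (simp add: right_diff_distrib sum_subtractf sum_distrib_right[symmetric])
    also have "(\<Sum>i\<le>n. A i * Y i) = (\<Sum>i | i \<le> n \<and> 0 < A i. A i * y i)"
    proof (rule sum.mono_neutral_cong_right)
      show "\<forall>i\<in>{..n} - {i. i \<le> n \<and> 0 < A i}. A i * Y i = 0" using A0 by force
    qed (auto simp: Y_def)
    finally show ?thesis by simp
  qed
  moreover have "f_tilde \<tau> f x (\<gamma> i) x = sup_fun \<tau> f x" if "i \<le> n" "0 < A i" for i
    using \<gamma>[OF that(1)] lim[OF that] by (intro f_tilde_self[of "F i"]) auto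
  ultimately show ?thesis
    unfolding n_def[symmetric] using A0 A1 act by (intro exI[of _ A] exI[of _ \<gamma>]) auto
qed

section \<open>The subdifferential is contained in the intersection\<close>

text \<open>The sum rule splits \<open>\<phi>\<close> along the regularizations with positive
  weight. The indicator leaves only inequalities on \<open>D\<close>, so the functionals may be
  replaced by continuous ones that agree with them on \<open>L\<close>.\<close>

lemma subdifferential_subset_hull:
  fixes f :: "'t \<Rightarrow> 'a::separated_lcs \<Rightarrow> ereal"
  assumes T: "topspace \<tau> \<noteq> {}" and f: "\<And>t. t \<in> topspace \<tau> \<Longrightarrow> econvex (f t)"
    and \<phi>: "\<phi> \<in> subdifferential (sup_fun \<tau> f) x" and L: "L \<in> fin_dim_subspaces x"
  shows "\<phi> \<in> convex hull (\<Union>\<gamma>\<in>active \<tau> f x.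
    subdifferential (\<lambda>z. f_tilde \<tau> f x \<gamma> z + eindicator (L \<inter> edom (sup_fun \<tau> f)) z) x)"
    (is "_ \<in> convex hull ?S")
proof -
  obtain B where B: "finite B" "L = span B" and xL: "x \<in> L" using L by (auto simp: fin_dim_subspaces_def)
  have \<phi>_dual: "\<phi> \<in> dual_space" and fin: "\<bar>sup_fun \<tau> f x\<bar> \<noteq> \<infinity>"
    and sub: "\<And>y. sup_fun \<tau> f x + ereal (\<phi> (y - x)) \<le> sup_fun \<tau> f y"
    using \<phi> by (auto simp: subdifferential_def split: if_splits)
  obtain c where c: "sup_fun \<tau> f x = ereal c" using fin by (cases "sup_fun \<tau> f x") auto
  note \<phi>_lin = dual_spaceD(1)[OF \<phi>_dual]
  define D where "D = span B \<inter> edom (sup_fun \<tau> f)"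
  have xD: "x \<in> D" using xL B(2) c by (simp add: D_def edom_def)
  have convD: "convex D"
    unfolding D_def by (intro convex_Int subspace_imp_convex subspace_span convex_edom_sup_fun f)
  have "\<And>z. ereal (c + \<phi> (z - x)) \<le> sup_fun \<tau> f z" using sub by (simp add: c)
  from finitely_many_active_indices[OF T f \<phi>_lin B(1) D_def xD c this]
  obtain a \<gamma> where a: "\<And>i. i \<le> card B \<Longrightarrow> 0 \<le> a i" "sum a {..card B} = 1"
    and \<gamma>: "\<And>i. i \<le> card B \<Longrightarrow> 0 < a i \<Longrightarrow> \<gamma> i \<in> active \<tau> f x"
      "\<And>i. i \<le> card B \<Longrightarrow> 0 < a i \<Longrightarrow> f_tilde \<tau> f x (\<gamma> i) x = sup_fun \<tau> f x"
    and main: "\<And>z y. z \<in> D \<Longrightarrow> (\<And>i. i \<le> card B \<Longrightarrow> 0 < a i \<Longrightarrow> f_tilde \<tau> f x (\<gamma> i) z < ereal (y i)) \<Longrightarrow>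
      c + \<phi> (z - x) \<le> (\<Sum>i | i \<le> card B \<and> 0 < a i. a i * y i)"
    by blast
  define I where "I = {i. i \<le> card B \<and> 0 < a i}"
  have I: "finite I" "\<And>i. i \<in> I \<Longrightarrow> 0 < a i" by (auto simp: I_def)
  have "sum a I = sum a {..card B}"
  proof (rule sum.mono_neutral_left)
    show "\<forall>i\<in>{..card B} - I. a i = 0" using a(1) unfolding I_def by force
  qed (auto simp: I_def)
  then have sumI: "sum a I = 1" using a(2) by simp
  then have I_ne: "I \<noteq> {}" by auto
  define G where "G = (\<lambda>i. {(z, r). z \<in> D \<and> f_tilde \<tau> f x (\<gamma> i) z < ereal r})"
  have "\<exists>l. (\<forall>i\<in>I. linear (l i) \<and> (\<forall>z y. (z, y) \<in> G i \<longrightarrow> c + l i (z - x) \<le> y)) \<and>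
    (\<forall>w\<in>span ((\<lambda>z. z - x) ` D). (\<Sum>i\<in>I. a i * l i w) = \<phi> w)"
  proof (rule convex_sum_rule[OF B(1) _ convD xD I sumI _ _ _ _ \<phi>_lin])
    show "D \<subseteq> span B" by (simp add: D_def)
    show "convex (G i)" for i unfolding G_def by (intro convex_strict_epigraph_f_tilde f convD)
    show "z \<in> D" if "(z, y) \<in> G i" for i z y using that by (simp add: G_def)
    show "\<exists>y. (z, y) \<in> G i" if z: "z \<in> D" for i z
    proof -
      have "f_tilde \<tau> f x (\<gamma> i) z < \<infinity>"
        using f_tilde_le_sup_fun[of \<tau> f x "\<gamma> i" z] z by (auto simp: D_def edom_def)
      then obtain y where "f_tilde \<tau> f x (\<gamma> i) z < ereal y" using ereal_dense2 by blast
      then show ?thesis using z by (auto simp: G_def)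
    qed
    show "(x, c + e) \<in> G i" if "i \<in> I" "0 < e" for i e
      using \<gamma>(2)[of i] that xD by (simp add: G_def I_def c)
    fix z y assume zy: "\<And>i. i \<in> I \<Longrightarrow> (z, y i) \<in> G i"
    then have "z \<in> D" using I_ne by (auto simp: G_def)
    then show "c + \<phi> (z - x) \<le> (\<Sum>i\<in>I. a i * y i)"
      unfolding I_def using zy by (intro main) (auto simp: G_def I_def)
  qed
  then obtain l where l: "\<And>i. i \<in> I \<Longrightarrow> linear (l i)"
    "\<And>i z y. i \<in> I \<Longrightarrow> (z, y) \<in> G i \<Longrightarrow> c + l i (z - x) \<le> y"
    "\<And>w. w \<in> span ((\<lambda>z. z - x) ` D) \<Longrightarrow> (\<Sum>i\<in>I. a i * l i w) = \<phi> w" by blast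
  have "\<forall>i\<in>I. \<exists>\<psi>. \<psi> \<in> dual_space \<and> (\<forall>y\<in>span B. \<psi> y = l i y)"
    using dual_space_extension[OF l(1) B(1)] by blast
  from bchoice[OF this] obtain \<psi> where \<psi>: "\<And>i. i \<in> I \<Longrightarrow> \<psi> i \<in> dual_space"
    "\<And>i y. i \<in> I \<Longrightarrow> y \<in> span B \<Longrightarrow> \<psi> i y = l i y" by blast
  \<comment> \<open>\<open>\<phi>' i\<close> is corrected off \<open>L\<close> so that the convex combination is \<open>\<phi>\<close> on the whole space.\<close>
  define \<phi>' where "\<phi>' = (\<lambda>i y. \<psi> i y + 1 * (\<phi> y + (-1) * (\<Sum>j\<in>I. a j * \<psi> j y)))"
  have \<phi>'_dual: "\<phi>' i \<in> dual_space" if "i \<in> I" for i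
    unfolding \<phi>'_def by (intro dual_space_add_scale dual_space_sum \<psi>(1) \<phi>_dual that)
  have DB: "z - x \<in> span B" if "z \<in> D" for z
    using that xD by (auto simp: D_def intro: span_diff)
  \<comment> \<open>The correction vanishes on \<open>D - x\<close>, where the weighted sum of the
    \<open>\<psi> j\<close> is already \<open>\<phi>\<close>.\<close>
  have \<phi>'_D: "\<phi>' i (z - x) = l i (z - x)" if i: "i \<in> I" and z: "z \<in> D" for i z
  proof -
    have "(\<Sum>j\<in>I. a j * \<psi> j (z - x)) = (\<Sum>j\<in>I. a j * l j (z - x))"
      using \<psi>(2) DB[OF z] by (intro sum.cong) auto
    also have "\<dots> = \<phi> (z - x)" using z by (intro l(3) span_base imageI)
    finally show ?thesis using \<psi>(2)[OF i DB[OF z]] by (simp add: \<phi>'_def)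
  qed
  have "\<phi>' i \<in> ?S" if i: "i \<in> I" for i
  proof -
    let ?h = "\<lambda>z. f_tilde \<tau> f x (\<gamma> i) z + eindicator (L \<inter> edom (sup_fun \<tau> f)) z"
    have LD: "L \<inter> edom (sup_fun \<tau> f) = D" using B(2) by (simp add: D_def)
    have hx: "?h x = ereal c" using \<gamma>(2)[of i] i xD by (simp add: LD eindicator_def c I_def)
    have "ereal c + ereal (\<phi>' i (y - x)) \<le> ?h y" for y
    proof (cases "y \<in> D")
      case True
      \<comment> \<open>The sum rule bounds only heights strictly above \<open>f_tilde\<close>;
        density of the reals gives the bound on \<open>f_tilde\<close> itself and excludes the value
        -\<infinity>.\<close>
      have "ereal (c + l i (y - x)) \<le> f_tilde \<tau> f x (\<gamma> i) y"
      proof (rule ccontr)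
        assume "\<not> ?thesis"
        then have "f_tilde \<tau> f x (\<gamma> i) y < ereal (c + l i (y - x))" by simp
        then obtain r where r: "f_tilde \<tau> f x (\<gamma> i) y < ereal r" "r < c + l i (y - x)"
          using ereal_dense2[of "f_tilde \<tau> f x (\<gamma> i) y" "ereal (c + l i (y - x))"] by auto
        then have "(y, r) \<in> G i" using True by (simp add: G_def)
        then show False using l(2)[OF i] r(2) by fastforce
      qed
      then show ?thesis using True \<phi>'_D[OF i True] by (simp add: LD eindicator_def)
    qed (simp add: LD eindicator_def)
    then have "\<phi>' i \<in> subdifferential ?h x" using \<phi>'_dual[OF i] hx by (simp add: subdifferential_def)
    then show ?thesis using \<gamma>(1)[of i] i by (auto simp: I_def)
  qed
  then have "(\<Sum>i\<in>I. a i *\<^sub>R \<phi>' i) \<in> convex hull ?S"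
    using I sumI by (intro convex_sum convex_convex_hull) (auto intro: hull_inc less_imp_le)
  also have "(\<Sum>i\<in>I. a i *\<^sub>R \<phi>' i) = \<phi>"
  proof
    fix y
    have "(\<Sum>i\<in>I. a i *\<^sub>R \<phi>' i) y = (\<Sum>i\<in>I. a i * \<psi> i y) + sum a I * (\<phi> y - (\<Sum>j\<in>I. a j * \<psi> j y))"
      unfolding sum_apply scaleR_fun_def real_scaleR_def \<phi>'_def
      by (simp add: distrib_left sum.distrib sum_distrib_right[symmetric])
    then show "(\<Sum>i\<in>I. a i *\<^sub>R \<phi>' i) y = \<phi> y" by (simp add: sumI)
  qed
  finally show ?thesis .
qed

theorem theorem6:
  fixes \<tau> :: "'t topology"
    and f :: "'t \<Rightarrow> 'a::separated_lcs \<Rightarrow> ereal"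
    and x :: 'a
  assumes "topspace \<tau> \<noteq> {}"
    and "\<And>t. t \<in> topspace \<tau> \<Longrightarrow> econvex (f t)"
  shows "subdifferential (sup_fun \<tau> f) x =
    (\<Inter>L\<in>fin_dim_subspaces x.
      convex hull (\<Union>\<gamma>\<in>active \<tau> f x.
        subdifferential (\<lambda>z. f_tilde \<tau> f x \<gamma> z + eindicator (L \<inter> edom (sup_fun \<tau> f)) z) x))"
proof (intro equalityI subsetI INT_I)
  fix \<phi> L assume "\<phi> \<in> subdifferential (sup_fun \<tau> f) x" "L \<in> fin_dim_subspaces x"
  with assms show "\<phi> \<in> convex hull (\<Union>\<gamma>\<in>active \<tau> f x.
        subdifferential (\<lambda>z. f_tilde \<tau> f x \<gamma> z + eindicator (L \<inter> edom (sup_fun \<tau> f)) z) x)"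
    by (rule subdifferential_subset_hull)
next
  fix \<phi> assume "\<phi> \<in> (\<Inter>L\<in>fin_dim_subspaces x. convex hull (\<Union>\<gamma>\<in>active \<tau> f x.
        subdifferential (\<lambda>z. f_tilde \<tau> f x \<gamma> z + eindicator (L \<inter> edom (sup_fun \<tau> f)) z) x))"
  then show "\<phi> \<in> subdifferential (sup_fun \<tau> f) x"
    by (intro Inter_hull_subset_subdifferential) blast
qed

end
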